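(* Let $r\ge2$ be a constant and $2r\log n\le\lambda\in O\!\left(\frac{n^{r-1}}{\log n}\right)$. Consider the island model with the complete migration topology on $\lambda$ islands and migration probability $1/\tau$ optimizing $\mathrm{Fork}_{n,r}$. Then the expected number of rounds $E(T)$ until some island has the optimum satisfies $E(T)\in\Omega\!\left(\frac{n^{3r}+\tau\lambda n^r}{\lambda n^r+\tau\lambda^2}\right)$.
   Context: $\mathrm{Fork}_{n,r}(x)=n+1$ if $x=0^r1^{n-r}$, $n+2$ if $x=1^{n-r}0^r$ (the optimum), and $|x|_1$ otherwise. Island model on graph $G=(V,E)$, $\lambda=|V|$, parameter $\tau\ge1$ (positive integer-valued, non-decreasing function of $n$): each island's solution is initialized independently uniformly at random. In each round: with probability $1/\tau$ a migration flag is set (the same for all islands); every island creates an offspring by flipping each bit of its solution independently with probability $1/n$ and replaces its solution if the offspring's fitness is not smaller; if the flag is set, every island sends its solution to all neighbours in $G$, and each island picks uniformly at random one of the received solutions of maximum fitness and replaces its own solution by it if it is not worse. The complete topology is the complete graph on $\lambda$ vertices. Asymptotics are in $n$. *)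

theory Defs
  imports "HOL-Probability.Probability" "HOL-Library.Landau_Symbols"
begin

text \<open>Bit strings of length n are represented as bool lists (True = 1).\<close>

definition ones :: "bool list \<Rightarrow> nat" where
  "ones x = length (filter id x)"

definition fork_trap :: "nat \<Rightarrow> nat \<Rightarrow> bool list" where
  "fork_trap n r = replicate r False @ replicate (n - r) True"

definition fork_opt :: "nat \<Rightarrow> nat \<Rightarrow> bool list" where
  "fork_opt n r = replicate (n - r) True @ replicate r False"

definition Fork :: "nat \<Rightarrow> nat \<Rightarrow> bool list \<Rightarrow> nat" where
  "Fork n r x = (if x = fork_trap n r then n + 1
                 else if x = fork_opt n r then n + 2
                 else ones x)"

fun seq_pmf :: "'a pmf list \<Rightarrow> 'a list pmf" where
  "seq_pmf [] = return_pmf []"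
| "seq_pmf (p # ps) = bind_pmf p (\<lambda>x. map_pmf (\<lambda>xs. x # xs) (seq_pmf ps))"

definition mutate :: "nat \<Rightarrow> bool list \<Rightarrow> bool list pmf" where
  "mutate n x = seq_pmf (map (\<lambda>b. map_pmf (\<lambda>fl. if fl then \<not> b else b)
                                        (bernoulli_pmf (1 / real n))) x)"

definition uniform_bits :: "nat \<Rightarrow> bool list pmf" where
  "uniform_bits n = pmf_of_set {x. length x = n}"

definition migrate :: "(bool list \<Rightarrow> nat) \<Rightarrow> (nat \<Rightarrow> nat set) \<Rightarrow> bool list list \<Rightarrow> nat
    \<Rightarrow> bool list pmf" where
  "migrate f nbrs zs i =
     (let R = {j \<in> nbrs i. j < length zs} in
      if R = {} then return_pmf (zs ! i)
      else (let M = Max ((\<lambda>j. f (zs ! j)) ` R);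
                C = {j \<in> R. f (zs ! j) = M}
            in map_pmf (\<lambda>j. if f (zs ! i) \<le> f (zs ! j) then zs ! j else zs ! i)
                 (pmf_of_set C)))"

definition island_round :: "nat \<Rightarrow> (bool list \<Rightarrow> nat) \<Rightarrow> nat \<Rightarrow> (nat \<Rightarrow> nat set)
    \<Rightarrow> bool list list \<Rightarrow> bool list list pmf" where
  "island_round n f tau nbrs xs =
     bind_pmf (bernoulli_pmf (1 / real tau)) (\<lambda>flag.
     bind_pmf (seq_pmf (map (mutate n) xs)) (\<lambda>ys.
       (let zs = map2 (\<lambda>x y. if f x \<le> f y then y else x) xs ys in
        if flag then seq_pmf (map (migrate f nbrs zs) [0..<length zs])
        else return_pmf zs)))"

definition complete_nbrs :: "nat \<Rightarrow> nat \<Rightarrow> nat set" where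
  "complete_nbrs lam i = {j. j < lam \<and> j \<noteq> i}"

definition island_init :: "nat \<Rightarrow> nat \<Rightarrow> bool list list pmf" where
  "island_init n lam = seq_pmf (replicate lam (uniform_bits n))"

definition has_opt :: "nat \<Rightarrow> nat \<Rightarrow> bool list list \<Rightarrow> bool" where
  "has_opt n r xs = (\<exists>x \<in> set xs. x = fork_opt n r)"

fun fork_dist :: "nat \<Rightarrow> nat \<Rightarrow> nat \<Rightarrow> nat \<Rightarrow> nat \<Rightarrow> bool list list pmf" where
  "fork_dist n r lam tau 0 = island_init n lam"
| "fork_dist n r lam tau (Suc t) =
     bind_pmf (fork_dist n r lam tau t) (\<lambda>xs.
       if has_opt n r xs then return_pmf xs
       else island_round n (Fork n r) tau (complete_nbrs lam) xs)"

text \<open>Expected number of rounds T until some island has the optimum: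
  E(T) = sum over t of Pr(T > t).\<close>
definition fork_ET :: "nat \<Rightarrow> nat \<Rightarrow> nat \<Rightarrow> nat \<Rightarrow> ennreal" where
  "fork_ET n r lam tau =
     (\<Sum>t. emeasure (measure_pmf (fork_dist n r lam tau t)) {xs. \<not> has_opt n r xs})"

end

theory Submission
  imports Defs "HOL-Combinatorics.Multiset_Permutations"
begin

text \<open>
  Write \<open>N = n^r\<close>. As long as no island has held the trap or the optimum, the process is the island model
  on OneMax, which commutes with permutations of the bit positions. Averaging over permutations shows
  that a given offspring is the trap with probability at most \<open>1 / (n choose r) = O(1/N)\<close>, however the
  islands have climbed so far, and that a given pair of offspring is (trap, optimum) with probability
  \<open>O(1/N^2)\<close>, even if the second one is created later by a migration-free run. The first
  bound alone gives \<open>E(T) = \<Omega>(N/\<lambda>)\<close>.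

  A permutation swapping trap and optimum shows that either is equally likely to be found first. Within
  \<open>O(n log n + N/\<lambda>) = O(N/\<lambda>)\<close> rounds all islands reach the all-ones string and one of the two is found, and
  by the pair bound with constant probability the trap is found, and the optimum is not found in the next
  \<open>w = \<delta>N/\<lambda>\<close> rounds without migration. Independently, a migration happens within these
  rounds with probability at least \<open>w/(\<tau> + w)\<close>, and it turns every island into the trap. From there
  the optimum requires flipping \<open>2r\<close> given bits, which takes \<open>N^2/\<lambda>\<close> rounds in expectation.
\<close>

section \<open>Products of independent distributions\<close>

abbreviation expect :: "'a pmf \<Rightarrow> ('a \<Rightarrow> ennreal) \<Rightarrow> ennreal" where
  "expect p f \<equiv> \<integral>\<^sup>+x. f x \<partial>measure_pmf p"

lemma expect_mono:
  assumes "\<And>x. x \<in> set_pmf p \<Longrightarrow> f x \<le> g x"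
  shows "expect p f \<le> expect p g"
  using assms by (intro nn_integral_mono_AE) (simp add: AE_measure_pmf_iff)

lemma expect_cong:
  assumes "\<And>x. x \<in> set_pmf p \<Longrightarrow> f x = g x"
  shows "expect p f = expect p g"
  using assms by (intro nn_integral_cong_AE) (simp add: AE_measure_pmf_iff)

lemma expect_const [simp]: "expect p (\<lambda>_. c) = c"
  by simp

lemma expect_of_bool_eq: "expect p (\<lambda>y. of_bool (y = x)) = ennreal (pmf p x)"
proof -
  have "expect p (\<lambda>y. of_bool (y = x)) = expect p (indicator {x})"
    by (intro nn_integral_cong) (auto simp: indicator_def)
  then show ?thesis by (simp add: emeasure_pmf_single)
qed

lemma expect_sum: "expect p (\<lambda>x. \<Sum>i\<in>A. f i x) = (\<Sum>i\<in>A. expect p (f i))"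
  by (rule nn_integral_sum) auto

lemma set_seq_pmf:
  "xs \<in> set_pmf (seq_pmf ps) \<longleftrightarrow> list_all2 (\<lambda>x p. x \<in> set_pmf p) xs ps"
  by (induction ps arbitrary: xs) (auto simp: list_all2_Cons2)

lemma length_seq_pmf: "xs \<in> set_pmf (seq_pmf ps) \<Longrightarrow> length xs = length ps"
  by (simp add: set_seq_pmf list_all2_lengthD)

lemma nth_seq_pmf:
  "xs \<in> set_pmf (seq_pmf ps) \<Longrightarrow> i < length ps \<Longrightarrow> xs ! i \<in> set_pmf (ps ! i)"
  by (auto simp: set_seq_pmf list_all2_conv_all_nth)

lemma map_pmf_map_seq_pmf:
  "map_pmf (map f) (seq_pmf ps) = seq_pmf (map (map_pmf f) ps)"
proof (induction ps)
  case (Cons p ps)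
  show ?case
    by (simp add: Cons.IH[symmetric] map_bind_pmf bind_map_pmf map_pmf_comp)
qed simp

lemma map_pmf_nth_seq_pmf:
  "i < length ps \<Longrightarrow> map_pmf (\<lambda>xs. xs ! i) (seq_pmf ps) = ps ! i"
proof (induction ps arbitrary: i)
  case (Cons p ps)
  then show ?case
    by (cases i) (auto simp: map_bind_pmf map_pmf_comp bind_return_pmf')
qed simp

lemma map_pmf_nth_pair_seq_pmf:
  "i < length ps \<Longrightarrow> j < length ps \<Longrightarrow> i \<noteq> j \<Longrightarrow>
     map_pmf (\<lambda>xs. (xs ! i, xs ! j)) (seq_pmf ps) = pair_pmf (ps ! i) (ps ! j)"
proof (induction ps arbitrary: i j)
  case (Cons p ps)
  consider (ij) i' j' where "i = Suc i'" "j = Suc j'" | (i) j' where "i = 0" "j = Suc j'"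
    | (j) i' where "i = Suc i'" "j = 0"
    using Cons.prems by (cases i; cases j) auto
  then show ?case
  proof cases
    case ij
    then show ?thesis using Cons by (simp add: map_bind_pmf map_pmf_comp)
  next
    case i
    have "map_pmf (\<lambda>xs. (x, xs ! j')) (seq_pmf ps) = map_pmf (Pair x) (ps ! j')" for x :: 'a
      using map_pmf_nth_seq_pmf[of j' ps] Cons.prems i
      by (simp flip: map_pmf_comp[of "Pair x" "\<lambda>xs. xs ! j'"])
    then show ?thesis using i
      by (simp add: map_bind_pmf map_pmf_comp pair_pmf_def map_pmf_def[of "Pair _"])
  next
    case j
    have "map_pmf (\<lambda>xs. (xs ! i', x)) (seq_pmf ps) = map_pmf (\<lambda>y. (y, x)) (ps ! i')" for x :: 'a
      using map_pmf_nth_seq_pmf[of i' ps] Cons.prems j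
      by (simp flip: map_pmf_comp[of "\<lambda>y. (y, x)" "\<lambda>xs. xs ! i'"])
    then show ?thesis using j
      by (simp add: map_bind_pmf map_pmf_comp pair_pmf_def map_pmf_def[of "\<lambda>y. (y, _)"])
        (rule bind_commute_pmf)
  qed
qed simp

lemma expect_nth_seq_pmf:
  assumes "i < length ps"
  shows "expect (seq_pmf ps) (\<lambda>xs. f (xs ! i)) = expect (ps ! i) f"
  using map_pmf_nth_seq_pmf[OF assms] by (metis nn_integral_map_pmf)

lemma expect_nth_pair_seq_pmf:
  assumes "i < length ps" "j < length ps" "i \<noteq> j"
  shows "expect (seq_pmf ps) (\<lambda>xs. f (xs ! i) * g (xs ! j)) = expect (ps ! i) f * expect (ps ! j) g"
proof -
  have "expect (seq_pmf ps) (\<lambda>xs. f (xs ! i) * g (xs ! j)) =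
      expect (map_pmf (\<lambda>xs. (xs ! i, xs ! j)) (seq_pmf ps)) (\<lambda>(x, y). f x * g y)"
    by simp
  also have "\<dots> = expect (ps ! i) f * expect (ps ! j) g"
    by (simp add: map_pmf_nth_pair_seq_pmf[OF assms] nn_integral_pair_pmf' nn_integral_cmult
      nn_integral_multc)
  finally show ?thesis .
qed

lemma pmf_seq_pmf:
  "length xs = length ps \<Longrightarrow> pmf (seq_pmf ps) xs = (\<Prod>i<length ps. pmf (ps ! i) (xs ! i))"
proof (induction ps arbitrary: xs)
  case (Cons p ps)
  then obtain y ys where xs: "xs = y # ys" "length ys = length ps" by (cases xs) auto
  have "ennreal (pmf (seq_pmf (p # ps)) xs) =
      expect p (\<lambda>x. expect (seq_pmf ps) (\<lambda>zs. of_bool (x = y) * of_bool (zs = ys)))"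
    by (auto simp flip: expect_of_bool_eq simp: xs intro!: nn_integral_cong)
  also have "\<dots> = ennreal (pmf p y * pmf (seq_pmf ps) ys)"
    by (simp add: nn_integral_cmult nn_integral_multc expect_of_bool_eq ennreal_mult)
  finally have "pmf (seq_pmf (p # ps)) xs = pmf p y * pmf (seq_pmf ps) ys"
    by (simp del: seq_pmf.simps)
  then show ?case
    using Cons.IH[OF xs(2)] by (simp add: xs prod.lessThan_Suc_shift del: seq_pmf.simps prod.lessThan_Suc)
qed simp

lemma inj_on_permute_list:
  assumes "\<pi> permutes {..<n}"
  shows "inj_on (permute_list \<pi>) {xs. length xs = n}"
proof (intro inj_onI nth_equalityI)
  fix xs ys :: "'a list" and i
  assume *: "xs \<in> {xs. length xs = n}" "ys \<in> {xs. length xs = n}"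
    "permute_list \<pi> xs = permute_list \<pi> ys" and i: "i < length xs"
  have "inv \<pi> i < n" using permutes_in_image[OF permutes_inv[OF assms], of i] i * by auto
  then have "xs ! \<pi> (inv \<pi> i) = ys ! \<pi> (inv \<pi> i)"
    using arg_cong[OF *(3), of "\<lambda>l. l ! inv \<pi> i"] *(1,2) assms
    by (simp add: permute_list_nth)
  then show "xs ! i = ys ! i" by (simp add: permutes_inverses[OF assms])
qed auto

lemma permute_list_surj:
  assumes "\<pi> permutes {..<length ys}"
  obtains xs where "length xs = length ys" "permute_list \<pi> xs = ys"
proof
  show "permute_list \<pi> (permute_list (inv \<pi>) ys) = ys"
    using permute_list_compose[OF assms, of "inv \<pi>"] permutes_inv_o[OF assms]
    by simp
qed simp

lemma map_pmf_permute_list_seq_pmf: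
  assumes "\<pi> permutes {..<length ps}"
  shows "map_pmf (permute_list \<pi>) (seq_pmf ps) = seq_pmf (permute_list \<pi> ps)"
proof (rule pmf_eqI)
  fix zs
  let ?n = "length ps"
  have inj: "inj_on (permute_list \<pi>) (set_pmf (seq_pmf ps))"
    using inj_on_permute_list[OF assms]
    by (rule inj_on_subset) (auto dest: length_seq_pmf)
  show "pmf (map_pmf (permute_list \<pi>) (seq_pmf ps)) zs = pmf (seq_pmf (permute_list \<pi> ps)) zs"
  proof (cases "length zs = ?n")
    case False
    then have "zs \<notin> set_pmf (map_pmf (permute_list \<pi>) (seq_pmf ps))"
      "zs \<notin> set_pmf (seq_pmf (permute_list \<pi> ps))"
      by (auto dest: length_seq_pmf)
    then show ?thesis unfolding set_pmf_iff by simp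
  next
    case True
    obtain ys where ys: "length ys = ?n" "permute_list \<pi> ys = zs"
      using permute_list_surj[of \<pi> zs] assms True by metis
    have "pmf (map_pmf (permute_list \<pi>) (seq_pmf ps)) zs = pmf (seq_pmf ps) ys"
    proof (cases "ys \<in> set_pmf (seq_pmf ps)")
      case True
      show ?thesis using pmf_map_inj[OF inj True] ys(2) by simp
    next
      case False
      have "zs \<noteq> permute_list \<pi> y" if y: "y \<in> set_pmf (seq_pmf ps)" for y
      proof
        assume "zs = permute_list \<pi> y"
        then have "permute_list \<pi> y = permute_list \<pi> ys" using ys(2) by simp
        then have "y = ys"
          by (rule inj_onD[OF inj_on_permute_list[OF assms]])
            (simp_all add: ys(1) length_seq_pmf[OF y])
        with y False show False by simp
      qed
      then have "zs \<notin> set_pmf (map_pmf (permute_list \<pi>) (seq_pmf ps))" by auto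
      with False show ?thesis unfolding set_pmf_iff by simp
    qed
    also have "\<dots> = (\<Prod>i<?n. pmf (ps ! i) (ys ! i))" using ys by (simp add: pmf_seq_pmf)
    also have "\<dots> = (\<Prod>i<?n. pmf (ps ! \<pi> i) (ys ! \<pi> i))"
      using prod.permute[OF assms, of "\<lambda>i. pmf (ps ! i) (ys ! i)"] by simp
    also have "\<dots> = pmf (seq_pmf (permute_list \<pi> ps)) zs"
      using ys assms by (subst pmf_seq_pmf) (auto intro!: prod.cong simp: permute_list_nth)
    finally show ?thesis .
  qed
qed

lemma pmf_permutation_invariant_le:
  assumes inv: "\<And>\<pi>. \<pi> permutes {..<n} \<Longrightarrow> map_pmf (permute_list \<pi>) p = p"
    and len: "\<And>y. y \<in> set_pmf p \<Longrightarrow> length y = n" and x: "length x = n"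
  shows "pmf p x \<le> 1 / card (permutations_of_multiset (mset x))"
proof -
  let ?O = "permutations_of_multiset (mset x)"
  have eq: "pmf p y = pmf p x" if "y \<in> ?O" for y
  proof -
    have my: "mset y = mset x" using that by (simp add: permutations_of_multiset_def)
    obtain \<pi> where \<pi>: "\<pi> permutes {..<length x}" "permute_list \<pi> x = y"
      using mset_eq_permutation[OF my] by metis
    have ly: "length y = n" using my x by (metis size_mset)
    have inj: "inj_on (permute_list \<pi>) (set_pmf p)"
      using inj_on_permute_list[of \<pi> n] \<pi>(1) x len by (auto intro: inj_on_subset)
    show ?thesis
    proof (cases "x \<in> set_pmf p")
      case True
      then show ?thesis using pmf_map_inj[OF inj True] inv[of \<pi>] \<pi> x by simp
    next
      case False
      have "y \<notin> set_pmf p"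
      proof
        assume "y \<in> set_pmf p"
        then have "y \<in> permute_list \<pi> ` set_pmf p"
          using inv[of \<pi>] \<pi>(1) x by (metis set_map_pmf)
        then obtain z where "z \<in> set_pmf p" "permute_list \<pi> z = permute_list \<pi> x"
          using \<pi>(2) by auto
        then show False
          using inj_on_permute_list[of \<pi> n] \<pi>(1) x len False by (auto simp: inj_on_def)
      qed
      then show ?thesis using False by (simp add: set_pmf_iff)
    qed
  qed
  have "real (card ?O) * pmf p x = (\<Sum>y\<in>?O. pmf p y)" by (simp add: eq)
  also have "\<dots> = measure (measure_pmf p) ?O"
    by (simp add: measure_measure_pmf_finite)
  also have "\<dots> \<le> 1" by simp
  finally have "real (card ?O) * pmf p x \<le> 1" .
  moreover have "card ?O > 0"
    by (simp add: card_gt_0_iff permutations_of_multiset_not_empty)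
  ultimately show ?thesis by (simp add: field_simps)
qed

lemma of_bool_mem_le_sum:
  assumes "length ys = m"
  shows "of_bool (y \<in> set ys) \<le> (\<Sum>i<m. of_bool (ys ! i = y) :: ennreal)"
proof (cases "y \<in> set ys")
  case True
  then obtain i where "i < m" "ys ! i = y" using assms by (auto simp: in_set_conv_nth)
  then show ?thesis using member_le_sum[of i "{..<m}" "\<lambda>i. of_bool (ys ! i = y) :: ennreal"] by auto
qed simp

lemma expect_mem_seq_pmf_le:
  "expect (seq_pmf ps) (\<lambda>xs. of_bool (y \<in> set xs)) \<le> (\<Sum>i<length ps. ennreal (pmf (ps ! i) y))"
proof -
  have "expect (seq_pmf ps) (\<lambda>xs. of_bool (y \<in> set xs)) \<le>
      expect (seq_pmf ps) (\<lambda>xs. \<Sum>i<length ps. of_bool (xs ! i = y))"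
    by (intro expect_mono of_bool_mem_le_sum length_seq_pmf)
  also have "\<dots> = (\<Sum>i<length ps. ennreal (pmf (ps ! i) y))"
    by (subst nn_integral_sum)
      (auto intro!: sum.cong simp: expect_nth_seq_pmf[where f = "\<lambda>x. of_bool (x = y)"] expect_of_bool_eq)
  finally show ?thesis .
qed

lemma expect_of_bool_add_not: "expect p (\<lambda>x. of_bool (P x)) + expect p (\<lambda>x. of_bool (\<not> P x)) = 1"
proof -
  have "expect p (\<lambda>x. of_bool (P x)) + expect p (\<lambda>x. of_bool (\<not> P x)) =
      expect p (\<lambda>x. of_bool (P x) + of_bool (\<not> P x))"
    by (rule nn_integral_add[symmetric]) auto
  also have "\<dots> = expect p (\<lambda>_. 1)" by (rule nn_integral_cong) auto
  finally show ?thesis by simp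
qed

lemma pmf_le_pmf_map: "pmf p x \<le> pmf (map_pmf f p) (f x)"
proof -
  have "pmf p x = measure (measure_pmf p) {x}" by (simp add: measure_pmf_single)
  also have "\<dots> \<le> measure (measure_pmf p) (f -` {f x})" by (intro measure_pmf.finite_measure_mono) auto
  finally show ?thesis by (simp add: pmf_map)
qed

lemma mem_map_permute_list:
  assumes "\<pi> permutes {..<n}" "\<forall>y\<in>set ys. length y = n" "length x = n" "permute_list \<pi> x = z"
  shows "z \<in> set (map (permute_list \<pi>) ys) \<longleftrightarrow> x \<in> set ys"
  using inj_on_image_mem_iff[OF inj_on_permute_list[OF assms(1)], of x "set ys"] assms(2-4) by auto

lemma one_minus_power_ge:
  assumes "tau \<ge> (1 :: real)"
  shows "real w / (tau + real w) \<le> 1 - (1 - 1 / tau) ^ w"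
proof -
  have "(1 - 1 / tau) ^ w \<le> exp (- (1 / tau)) ^ w"
    using assms exp_ge_add_one_self[of "- (1 / tau)"] by (intro power_mono) auto
  also have "\<dots> = 1 / exp (w / tau)"
    by (simp add: exp_minus field_simps flip: exp_of_nat_mult)
  also have "\<dots> \<le> 1 / (1 + w / tau)"
    using assms exp_ge_add_one_self[of "w / tau"] by (intro divide_left_mono) (auto intro!: mult_pos_pos add_pos_nonneg)
  also have "\<dots> = 1 - w / (tau + w)" using assms by (simp add: field_simps)
  finally show ?thesis by simp
qed

lemma one_minus_power_le_exp:
  assumes "0 \<le> x" "x \<le> (1 :: real)"
  shows "(1 - x) ^ k \<le> exp (- (x * real k))"
proof -
  have "(1 - x) ^ k \<le> exp (- x) ^ k"
    using assms exp_ge_add_one_self[of "- x"] by (intro power_mono) auto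
  then show ?thesis by (simp add: mult.commute flip: exp_of_nat_mult)
qed

section \<open>One round of the island model\<close>

lemma pmf_mutate:
  assumes "n \<ge> 1" "length y = length x"
  shows "pmf (mutate n x) y = (1 / n) ^ card {i. i < length x \<and> x ! i \<noteq> y ! i} *
    (1 - 1 / n) ^ card {i. i < length x \<and> x ! i = y ! i}"
proof -
  have 1: "pmf (map_pmf (\<lambda>fl. if fl then \<not> b else b) (bernoulli_pmf (1 / real n))) c =
      (if b = c then 1 - 1 / n else 1 / n)" for b c
  proof -
    have eq: "(\<lambda>fl. if fl then \<not> b else b) -` {c} = {b \<noteq> c}" by auto
    show ?thesis using assms(1)
      by (simp add: pmf_map eq measure_pmf_single)
  qed
  have "pmf (mutate n x) y = (\<Prod>i<length x. if x ! i = y ! i then 1 - 1 / n else 1 / n)"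
    unfolding mutate_def using assms(2) by (subst pmf_seq_pmf) (auto simp: 1 intro!: prod.cong)
  also have "\<dots> = (1 - 1 / n) ^ card ({..<length x} \<inter> {i. x ! i = y ! i}) *
      (1 / n) ^ card ({..<length x} \<inter> - {i. x ! i = y ! i})"
    by (subst prod.If_cases) auto
  also have "{..<length x} \<inter> {i. x ! i = y ! i} = {i. i < length x \<and> x ! i = y ! i}" by auto
  also have "{..<length x} \<inter> - {i. x ! i = y ! i} = {i. i < length x \<and> x ! i \<noteq> y ! i}" by auto
  finally show ?thesis by (simp add: mult.commute)
qed

lemma length_mutate: "y \<in> set_pmf (mutate n x) \<Longrightarrow> length y = length x"
  by (auto simp: mutate_def dest: length_seq_pmf)

lemma mutate_permute_list:
  assumes "\<pi> permutes {..<length x}"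
  shows "mutate n (permute_list \<pi> x) = map_pmf (permute_list \<pi>) (mutate n x)"
  using assms by (simp add: mutate_def map_pmf_permute_list_seq_pmf permute_list_map)

lemma ones_permute_list:
  assumes "\<pi> permutes {..<length x}"
  shows "ones (permute_list \<pi> x) = ones x"
proof -
  have "ones y = size (filter_mset id (mset y))" for y
    unfolding ones_def by (metis mset_filter size_mset)
  then show ?thesis by (simp add: mset_permute_list[OF assms])
qed

lemma ones_le_length: "ones x \<le> length x"
  by (simp add: ones_def)

lemma migrate_complete_support:
  assumes "length zs = lam" "i < lam" "z \<in> set_pmf (migrate f (complete_nbrs lam) zs i)"
  shows "z \<in> set zs" "\<And>y. y \<in> set zs \<Longrightarrow> f y \<le> f z"
proof -
  define R where "R = {j \<in> complete_nbrs lam i. j < length zs}"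
  define M where "M = Max ((\<lambda>j. f (zs ! j)) ` R)"
  define C where "C = {j \<in> R. f (zs ! j) = M}"
  have R: "R = {j. j < lam \<and> j \<noteq> i}" using assms by (auto simp: R_def complete_nbrs_def)
  then have fin: "finite R" by simp
  have *: "z \<in> set zs \<and> (\<forall>y\<in>set zs. f y \<le> f z)"
  proof (cases "R = {}")
    case True
    then have "z = zs ! i" using assms(3) by (simp add: migrate_def R_def[symmetric])
    moreover have "lam = 1"
    proof (rule ccontr)
      assume "lam \<noteq> 1"
      then have "(if i = 0 then 1 else 0) \<in> R" using R assms(2) by auto
      then show False using True by simp
    qed
    ultimately show ?thesis using assms(1,2) by (auto simp: in_set_conv_nth)
  next
    case False
    have "M \<in> (\<lambda>j. f (zs ! j)) ` R" unfolding M_def using False fin by (intro Max_in) auto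
    then have "C \<noteq> {}" by (auto simp: C_def)
    moreover have "finite C" using fin by (simp add: C_def)
    moreover have "migrate f (complete_nbrs lam) zs i =
        map_pmf (\<lambda>j. if f (zs ! i) \<le> f (zs ! j) then zs ! j else zs ! i) (pmf_of_set C)"
      using False unfolding migrate_def Let_def R_def[symmetric] M_def[symmetric] C_def[symmetric]
      by simp
    ultimately have "z \<in> (\<lambda>j. if f (zs ! i) \<le> f (zs ! j) then zs ! j else zs ! i) ` C"
      using assms(3) by simp
    then obtain j where j: "j \<in> C" "z = (if f (zs ! i) \<le> f (zs ! j) then zs ! j else zs ! i)"
      by blast
    have Mz: "M \<le> f z" "f (zs ! i) \<le> f z" using j by (auto simp: C_def)
    have "f y \<le> f z" if y: "y \<in> set zs" for y
    proof -
      obtain k where k: "k < lam" "y = zs ! k" using y assms(1) by (auto simp: in_set_conv_nth)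
      show ?thesis
      proof (cases "k = i")
        case False
        then have "f y \<le> M" unfolding M_def using k R fin by (intro Max_ge) auto
        with Mz show ?thesis by simp
      qed (use k Mz in simp)
    qed
    moreover have "z \<in> set zs" using j R assms by (auto simp: C_def)
    ultimately show ?thesis by blast
  qed
  then show "z \<in> set zs" "\<And>y. y \<in> set zs \<Longrightarrow> f y \<le> f z" by auto
qed

lemma migrate_map:
  assumes "\<And>z. z \<in> set zs \<Longrightarrow> f (g z) = f z" "i < length zs"
  shows "migrate f nbrs (map g zs) i = map_pmf g (migrate f nbrs zs i)"
proof -
  define R where "R = {j \<in> nbrs i. j < length zs}"
  have fg: "f (g (zs ! j)) = f (zs ! j)" if "j < length zs" for j using assms(1) that by simp
  have im: "(\<lambda>j. f (map g zs ! j)) ` R = (\<lambda>j. f (zs ! j)) ` R"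
    by (intro image_cong) (auto simp: R_def fg)
  define M where "M = Max ((\<lambda>j. f (zs ! j)) ` R)"
  define C where "C = {j \<in> R. f (zs ! j) = M}"
  have C: "{j \<in> R. f (map g zs ! j) = M} = C" by (auto simp: R_def C_def fg)
  show ?thesis
  proof (cases "R = {}")
    case True
    then show ?thesis using assms(2) by (simp add: migrate_def R_def[symmetric])
  next
    case False
    have fin: "finite R" by (simp add: R_def)
    have "M \<in> (\<lambda>j. f (zs ! j)) ` R" unfolding M_def using False fin by (intro Max_in) auto
    then have ne: "C \<noteq> {}" "finite C" using fin by (auto simp: C_def)
    have "migrate f nbrs (map g zs) i =
        map_pmf (\<lambda>j. if f (map g zs ! i) \<le> f (map g zs ! j) then map g zs ! j else map g zs ! i)
          (pmf_of_set C)"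
      using False unfolding migrate_def Let_def length_map R_def[symmetric] im
        M_def[symmetric] C by simp
    also have "\<dots> = map_pmf (\<lambda>j. g (if f (zs ! i) \<le> f (zs ! j) then zs ! j else zs ! i))
          (pmf_of_set C)"
      using ne assms(2) by (intro map_pmf_cong) (auto simp: C_def R_def fg)
    also have "\<dots> = map_pmf g (migrate f nbrs zs i)"
      using False unfolding migrate_def Let_def R_def[symmetric]
        M_def[symmetric] C_def[symmetric] by (simp add: map_pmf_comp)
    finally show ?thesis .
  qed
qed

definition select :: "(bool list \<Rightarrow> nat) \<Rightarrow> bool list \<Rightarrow> bool list \<Rightarrow> bool list" where
  "select f x y = (if f x \<le> f y then y else x)"

definition migration :: "nat \<Rightarrow> (bool list \<Rightarrow> nat) \<Rightarrow> bool \<Rightarrow> bool list list \<Rightarrow> bool list list pmf" where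
  "migration lam f flag zs =
     (if flag then seq_pmf (map (migrate f (complete_nbrs lam) zs) [0..<length zs])
      else return_pmf zs)"

lemma island_round_eq:
  "island_round n f tau (complete_nbrs lam) xs =
     bind_pmf (bernoulli_pmf (1 / real tau)) (\<lambda>flag.
     bind_pmf (seq_pmf (map (mutate n) xs)) (\<lambda>ys.
       migration lam f flag (map2 (select f) xs ys)))"
  by (simp add: island_round_def migration_def select_def[abs_def] Let_def)

lemma migration_support:
  assumes "length zs = lam" "ws \<in> set_pmf (migration lam f flag zs)"
  shows "length ws = lam" "set ws \<subseteq> set zs" "\<And>i. i < lam \<Longrightarrow> f (zs ! i) \<le> f (ws ! i)"
proof -
  have *: "length ws = lam \<and> (\<forall>i<lam. ws ! i \<in> set zs \<and> f (zs ! i) \<le> f (ws ! i))"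
  proof (cases flag)
    case True
    then have ws: "ws \<in> set_pmf (seq_pmf (map (migrate f (complete_nbrs lam) zs) [0..<lam]))"
      using assms by (simp add: migration_def)
    then have len: "length ws = lam" by (auto dest: length_seq_pmf)
    moreover have "ws ! i \<in> set zs \<and> f (zs ! i) \<le> f (ws ! i)" if "i < lam" for i
    proof -
      have "ws ! i \<in> set_pmf (migrate f (complete_nbrs lam) zs i)"
        using nth_seq_pmf[OF ws, of i] that by simp
      from migrate_complete_support[OF assms(1) that this] show ?thesis
        using assms(1) that by auto
    qed
    ultimately show ?thesis by blast
  qed (use assms in \<open>auto simp: migration_def\<close>)
  then show "length ws = lam" "\<And>i. i < lam \<Longrightarrow> f (zs ! i) \<le> f (ws ! i)" by auto
  show "set ws \<subseteq> set zs" using * by (auto simp: in_set_conv_nth subset_iff)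
qed

lemma migration_map:
  assumes "\<And>z. z \<in> set zs \<Longrightarrow> f (g z) = f z"
  shows "migration lam f flag (map g zs) = map_pmf (map g) (migration lam f flag zs)"
proof -
  have "map (migrate f (complete_nbrs lam) (map g zs)) [0..<length zs] =
      map (map_pmf g \<circ> migrate f (complete_nbrs lam) zs) [0..<length zs]"
    using migrate_map[of zs f g] assms by auto
  then show ?thesis by (auto simp: migration_def map_pmf_map_seq_pmf simp del: map_eq_conv)
qed

lemma migration_cong:
  assumes "\<And>z. z \<in> set zs \<Longrightarrow> f z = g z"
  shows "migration lam f flag zs = migration lam g flag zs"
proof -
  have "migrate f (complete_nbrs lam) zs i = migrate g (complete_nbrs lam) zs i" if "i < length zs" for i
  proof -
    define R where "R = {j \<in> complete_nbrs lam i. j < length zs}"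
    have fg: "f (zs ! j) = g (zs ! j)" if "j < length zs" for j using assms that by simp
    have im: "(\<lambda>j. f (zs ! j)) ` R = (\<lambda>j. g (zs ! j)) ` R"
      by (intro image_cong) (auto simp: R_def fg)
    have C: "{j \<in> R. f (zs ! j) = M} = {j \<in> R. g (zs ! j) = M}" for M
      by (auto simp: R_def fg)
    define M where "M = Max ((\<lambda>j. g (zs ! j)) ` R)"
    define C where "C = {j \<in> R. g (zs ! j) = M}"
    show ?thesis
    proof (cases "R = {}")
      case True
      then show ?thesis by (simp add: migrate_def R_def[symmetric])
    next
      case False
      have fin: "finite R" by (simp add: R_def)
      have "M \<in> (\<lambda>j. g (zs ! j)) ` R" unfolding M_def using False fin by (intro Max_in) auto
      then have ne: "C \<noteq> {}" "finite C" using fin by (auto simp: C_def)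
      show ?thesis
        unfolding migrate_def Let_def R_def[symmetric] im C
        unfolding M_def[symmetric] C_def[symmetric]
        by (rule if_cong[OF refl refl], rule map_pmf_cong[OF refl])
          (use ne that in \<open>simp add: C_def R_def fg\<close>)
    qed
  qed
  then have "map (migrate f (complete_nbrs lam) zs) [0..<length zs] =
      map (migrate g (complete_nbrs lam) zs) [0..<length zs]" by auto
  then show ?thesis by (simp add: migration_def del: map_eq_conv)
qed

lemma ones_eq_card: "ones x = card {i. i < length x \<and> x ! i}"
  by (simp add: ones_def length_filter_conv_card)

lemma zeros_eq_card: "length x - ones x = card {i. i < length x \<and> \<not> x ! i}"
proof -
  have "{i. i < length x \<and> x ! i} \<union> {i. i < length x \<and> \<not> x ! i} = {..<length x}" by auto
  moreover have "card ({i. i < length x \<and> x ! i} \<union> {i. i < length x \<and> \<not> x ! i}) =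
      ones x + card {i. i < length x \<and> \<not> x ! i}"
    unfolding ones_eq_card by (rule card_Un_disjoint) auto
  ultimately have "ones x + card {i. i < length x \<and> \<not> x ! i} = length x" by simp
  then show ?thesis by simp
qed

lemma ones_list_update: "i < length x \<Longrightarrow> \<not> x ! i \<Longrightarrow> ones (x[i := True]) = Suc (ones x)"
proof -
  assume i: "i < length x" "\<not> x ! i"
  then have "{j. j < length (x[i := True]) \<and> x[i := True] ! j} = insert i {j. j < length x \<and> x ! j}"
    by (auto simp: nth_list_update)
  then show ?thesis using i unfolding ones_eq_card by simp
qed

lemma one_minus_inverse_power_ge:
  assumes "n \<ge> 2"
  shows "1 / 3 \<le> (1 - 1 / real n) ^ (n - 1)"
proof -
  have "(1 + 1 / real (n - 1)) ^ (n - 1) \<le> exp (1 / real (n - 1)) ^ (n - 1)"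
    by (intro power_mono exp_ge_add_one_self) auto
  also have "\<dots> = exp 1" using assms by (simp flip: exp_of_nat_mult)
  also have "\<dots> \<le> 3" by (rule exp_le)
  finally have le: "(1 + 1 / real (n - 1)) ^ (n - 1) \<le> 3" .
  have "1 - 1 / real n = 1 / (1 + 1 / real (n - 1))"
    using assms by (simp add: field_simps of_nat_diff)
  then have "(1 - 1 / real n) ^ (n - 1) = 1 / (1 + 1 / real (n - 1)) ^ (n - 1)"
    by (simp add: power_divide)
  moreover have "1 / 3 \<le> 1 / (1 + 1 / real (n - 1)) ^ (n - 1)"
    using le by (intro divide_left_mono) (auto intro!: mult_pos_pos zero_less_power add_pos_nonneg)
  ultimately show ?thesis by simp
qed

lemma expect_all_seq_pmf:
  "expect (seq_pmf ps) (\<lambda>xs. of_bool (\<forall>x\<in>set xs. P x)) = prod_list (map (\<lambda>p. expect p (\<lambda>x. of_bool (P x))) ps)"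
proof (induction ps)
  case (Cons p ps)
  have "expect (seq_pmf (p # ps)) (\<lambda>xs. of_bool (\<forall>x\<in>set xs. P x)) =
      expect p (\<lambda>x. of_bool (P x) * expect (seq_pmf ps) (\<lambda>xs. of_bool (\<forall>x\<in>set xs. P x)))"
    by (simp add: of_bool_conj nn_integral_cmult)
  also have "\<dots> = expect p (\<lambda>x. of_bool (P x)) * expect (seq_pmf ps) (\<lambda>xs. of_bool (\<forall>x\<in>set xs. P x))"
    by (rule nn_integral_multc) auto
  finally show ?case using Cons.IH by simp
qed simp

lemma ennreal_le_of_add_le:
  assumes "a + ennreal b \<le> ennreal c" "0 \<le> b"
  shows "a \<le> ennreal (c - b)"
proof (cases a)
  case (real x)
  then have "ennreal (x + b) \<le> ennreal c" using assms by simp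
  then have "x + b \<le> c \<or> x + b \<le> 0" unfolding ennreal_le_iff2 by auto
  then have "x \<le> c - b \<or> x = 0" using real assms by auto
  then show ?thesis using real by (auto intro: ennreal_leI)
qed (use assms in \<open>simp add: top_unique\<close>)

section \<open>The island model on Fork\<close>

locale fork_model =
  fixes n r lam tau :: nat
  assumes r_pos: "r \<ge> 1" and two_r_le_n: "2 * r \<le> n" and lam_pos: "lam \<ge> 1" and tau_pos: "tau \<ge> 1"
begin

abbreviation "trap \<equiv> fork_trap n r"
abbreviation "opt \<equiv> fork_opt n r"
abbreviation "fork \<equiv> Fork n r"
abbreviation "offspring xs \<equiv> seq_pmf (map (mutate n) xs)"
abbreviation "fork_round \<equiv> island_round n fork tau (complete_nbrs lam)"
abbreviation "flag \<equiv> bernoulli_pmf (1 / real tau)"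

lemma n_ge_2: "n \<ge> 2" using r_pos two_r_le_n by simp

lemma length_trap [simp]: "length trap = n" and length_opt [simp]: "length opt = n"
  using two_r_le_n by (auto simp: fork_trap_def fork_opt_def)

lemma nth_trap: "i < n \<Longrightarrow> trap ! i \<longleftrightarrow> r \<le> i" and nth_opt: "i < n \<Longrightarrow> opt ! i \<longleftrightarrow> i < n - r"
  using two_r_le_n by (auto simp: fork_trap_def fork_opt_def nth_append)

lemma trap_neq_opt [simp]: "trap \<noteq> opt" "opt \<noteq> trap"
  using nth_trap[of 0] nth_opt[of 0] two_r_le_n r_pos by auto

lemma fork_trap [simp]: "fork trap = n + 1" and fork_opt [simp]: "fork opt = n + 2"
  by (auto simp: Fork_def)

lemma fork_other: "x \<noteq> trap \<Longrightarrow> x \<noteq> opt \<Longrightarrow> fork x = ones x"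
  by (simp add: Fork_def)

lemma fork_other_le: "length x = n \<Longrightarrow> x \<noteq> trap \<Longrightarrow> x \<noteq> opt \<Longrightarrow> fork x \<le> n"
  using ones_le_length[of x] by (simp add: Fork_def)

lemma fork_ge_iff_trap: "length x = n \<Longrightarrow> n + 1 \<le> fork x \<longleftrightarrow> x = opt \<or> x = trap"
  using fork_other_le[of x] by (cases "x = trap"; cases "x = opt") auto

lemma has_opt_iff: "has_opt n r xs \<longleftrightarrow> opt \<in> set xs"
  by (auto simp: has_opt_def)

definition good :: "bool list list \<Rightarrow> bool" where
  "good xs \<longleftrightarrow> length xs = lam \<and> (\<forall>x\<in>set xs. length x = n)"

definition clean :: "bool list list \<Rightarrow> bool" where
  "clean xs \<longleftrightarrow> good xs \<and> trap \<notin> set xs \<and> opt \<notin> set xs"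

lemma good_nth: "good xs \<Longrightarrow> i < lam \<Longrightarrow> length (xs ! i) = n"
  and good_length: "good xs \<Longrightarrow> length xs = lam"
  by (auto simp: good_def)

lemma clean_good: "clean xs \<Longrightarrow> good xs" by (simp add: clean_def)

lemma clean_nth: "clean xs \<Longrightarrow> i < lam \<Longrightarrow> xs ! i \<noteq> trap \<and> xs ! i \<noteq> opt \<and> length (xs ! i) = n"
  by (metis clean_def good_def nth_mem)

lemma goodI: "length xs = lam \<Longrightarrow> (\<And>i. i < lam \<Longrightarrow> length (xs ! i) = n) \<Longrightarrow> good xs"
  by (auto simp: good_def in_set_conv_nth)

lemma offspring_good:
  assumes "good xs" "ys \<in> set_pmf (offspring xs)"
  shows "good ys"
proof (rule goodI)
  show len: "length ys = lam" using assms length_seq_pmf[OF assms(2)] by (simp add: good_def)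
  show "length (ys ! i) = n" if "i < lam" for i
    using nth_seq_pmf[OF assms(2), of i] length_mutate good_nth[OF assms(1) that] that
      good_length[OF assms(1)] by simp
qed

lemma select_good: "good xs \<Longrightarrow> good ys \<Longrightarrow> good (map2 (select f) xs ys)"
  by (rule goodI) (auto simp: good_length good_nth select_def)

lemma nth_select:
  "good xs \<Longrightarrow> good ys \<Longrightarrow> i < lam \<Longrightarrow> map2 (select f) xs ys ! i = select f (xs ! i) (ys ! i)"
  by (simp add: good_length)

lemma migration_good: "good zs \<Longrightarrow> ws \<in> set_pmf (migration lam f fl zs) \<Longrightarrow> good ws"
  using migration_support[of zs lam ws f fl] by (auto simp: good_def)

lemma migration_clean: "clean zs \<Longrightarrow> ws \<in> set_pmf (migration lam f fl zs) \<Longrightarrow> clean ws"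
  using migration_support[of zs lam ws f fl] by (auto simp: clean_def good_def)

lemma select_fork_trap: "length x = n \<Longrightarrow> x \<noteq> opt \<Longrightarrow> select fork x trap = trap"
  and select_fork_opt: "length x = n \<Longrightarrow> select fork x opt = opt"
  using fork_other_le[of x] by (cases "x = trap"; cases "x = opt"; auto simp: select_def)+

lemma select_fork_other:
  assumes "x \<noteq> trap" "x \<noteq> opt" "y \<noteq> trap" "y \<noteq> opt"
  shows "select fork x y = select ones x y" "select f x y \<noteq> trap" "select f x y \<noteq> opt"
  using assms by (auto simp: select_def fork_other)

lemma select_fork_from_trap: "length y = n \<Longrightarrow> select fork trap y = (if y = opt then opt else trap)"
  using fork_other_le[of y] by (cases "y = trap"; cases "y = opt") (auto simp: select_def)

lemma select_fork_from_opt: "length y = n \<Longrightarrow> select fork opt y = opt"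
  using fork_other_le[of y] by (cases "y = trap"; cases "y = opt") (auto simp: select_def)

lemma select_fork_opt_iff:
  "length x = n \<Longrightarrow> length y = n \<Longrightarrow> select fork x y = opt \<longleftrightarrow> x = opt \<or> y = opt"
  using select_fork_from_opt[of y] select_fork_opt[of x]
  by (cases "x = opt"; cases "y = opt") (auto simp: select_def)

lemma select_clean:
  assumes "clean xs" "clean ys"
  shows "map2 (select fork) xs ys = map2 (select ones) xs ys" "clean (map2 (select f) xs ys)"
proof -
  have len: "length xs = lam" "length ys = lam" using assms by (auto simp: clean_def good_def)
  show "map2 (select fork) xs ys = map2 (select ones) xs ys"
    using clean_nth[OF assms(1)] clean_nth[OF assms(2)] len
    by (intro nth_equalityI) (auto simp: select_fork_other)
  show "clean (map2 (select f) xs ys)"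
    using clean_nth[OF assms(1)] clean_nth[OF assms(2)] len select_good[of xs ys f]
      clean_good[OF assms(1)] clean_good[OF assms(2)]
    by (auto simp: clean_def in_set_conv_nth select_fork_other) (metis select_fork_other(2,3))+
qed

lemma select_trap:
  assumes "good xs" "opt \<notin> set xs" "good ys" "trap \<in> set ys \<or> trap \<in> set xs" "opt \<notin> set ys"
  shows "trap \<in> set (map2 (select fork) xs ys)" "opt \<notin> set (map2 (select fork) xs ys)"
proof -
  have len: "length xs = lam" "length ys = lam" using assms by (auto simp: good_def)
  have no: "xs ! i \<noteq> opt" "ys ! i \<noteq> opt" if "i < lam" for i
    using assms that len by (metis nth_mem)+
  obtain i where i: "i < lam" "ys ! i = trap \<or> xs ! i = trap"
    using assms(4) len by (auto simp: in_set_conv_nth)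
  have "map2 (select fork) xs ys ! i = trap"
    using i no[of i] nth_select[OF assms(1,3) i(1)] good_nth[OF assms(1)] good_nth[OF assms(3)]
    by (auto simp: select_fork_trap select_fork_from_trap)
  then show "trap \<in> set (map2 (select fork) xs ys)"
    using i len nth_mem[of i "map2 (select fork) xs ys"] by simp
  show "opt \<notin> set (map2 (select fork) xs ys)"
  proof
    assume "opt \<in> set (map2 (select fork) xs ys)"
    then obtain i where "i < lam" "map2 (select fork) xs ys ! i = opt"
      using len by (auto simp: in_set_conv_nth)
    then show False
      using no[of i] nth_select[OF assms(1,3), of i] good_nth[OF assms(1)] good_nth[OF assms(3)]
      by (simp add: select_fork_opt_iff)
  qed
qed

lemma migration_trap:
  assumes "good zs" "trap \<in> set zs" "opt \<notin> set zs"
  shows "migration lam fork True zs = return_pmf (replicate lam trap)"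
  unfolding set_pmf_subset_singleton[symmetric]
proof
  fix ws assume "ws \<in> set_pmf (migration lam fork True zs)"
  then have ws: "ws \<in> set_pmf (seq_pmf (map (migrate fork (complete_nbrs lam) zs) [0..<lam]))"
    using assms by (simp add: migration_def good_def)
  have "ws ! i = trap" if "i < lam" for i
  proof -
    have *: "ws ! i \<in> set_pmf (migrate fork (complete_nbrs lam) zs i)"
      using nth_seq_pmf[OF ws, of i] that by simp
    have "fork trap \<le> fork (ws ! i)" "ws ! i \<in> set zs"
      using migrate_complete_support[OF good_length[OF assms(1)] that *] assms(2) by blast+
    moreover have "length (ws ! i) = n" "ws ! i \<noteq> opt"
      using \<open>ws ! i \<in> set zs\<close> assms by (auto simp: good_def)
    ultimately show ?thesis using fork_ge_iff_trap by auto
  qed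
  then have "ws = replicate lam trap"
    using length_seq_pmf[OF ws] by (intro nth_equalityI) auto
  then show "ws \<in> {replicate lam trap}" by simp
qed

lemma expect_flag: "expect flag f = f True * ennreal (1 / tau) + f False * ennreal (1 - 1 / tau)"
  using tau_pos by (simp add: ennreal_minus)

definition step :: "bool list list \<Rightarrow> bool list list pmf" where
  "step xs = (if has_opt n r xs then return_pmf xs else fork_round xs)"

primrec run :: "nat \<Rightarrow> bool list list \<Rightarrow> bool list list pmf" where
  "run 0 xs = return_pmf xs"
| "run (Suc k) xs = bind_pmf (step xs) (run k)"

definition remaining :: "bool list list \<Rightarrow> ennreal" where
  "remaining xs = (\<Sum>k. emeasure (measure_pmf (run k xs)) {ys. \<not> has_opt n r ys})"

lemma run_0: "run 0 = return_pmf"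
  by (rule ext) simp

lemma run_Suc_right: "run (Suc k) xs = bind_pmf (run k xs) step"
proof (induction k arbitrary: xs)
  case (Suc k)
  show ?case by (subst run.simps) (simp only: Suc.IH[abs_def] run.simps bind_assoc_pmf)
qed (simp add: run_0 bind_return_pmf bind_return_pmf')

lemma fork_dist_eq: "fork_dist n r lam tau t = bind_pmf (island_init n lam) (run t)"
proof (induction t)
  case (Suc t)
  show ?case by (simp add: Suc.IH run_Suc_right bind_assoc_pmf step_def[abs_def] del: run.simps)
qed (simp add: run_0 bind_return_pmf')

lemma fork_ET_eq: "fork_ET n r lam tau = expect (island_init n lam) remaining"
  unfolding fork_ET_def fork_dist_eq remaining_def emeasure_bind_pmf
  by (rule nn_integral_suminf[symmetric]) auto

lemma remaining_unfold:
  assumes "\<not> has_opt n r xs"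
  shows "remaining xs = expect (fork_round xs) remaining + 1"
proof -
  let ?A = "{ys. \<not> has_opt n r ys}"
  have "(\<Sum>k. emeasure (measure_pmf (run (Suc k) xs)) ?A) = expect (step xs) remaining"
    unfolding remaining_def run.simps emeasure_bind_pmf
    by (rule nn_integral_suminf[symmetric]) auto
  moreover have "(\<lambda>k. emeasure (measure_pmf (run (Suc k) xs)) ?A) sums
      (\<Sum>k. emeasure (measure_pmf (run (Suc k) xs)) ?A)"
    by (intro summable_sums summableI)
  ultimately have "(\<lambda>k. emeasure (measure_pmf (run (Suc k) xs)) ?A) sums expect (step xs) remaining"
    by simp
  from sums_Suc[of "\<lambda>k. emeasure (measure_pmf (run k xs)) ?A", OF this] assms
  show ?thesis unfolding remaining_def[of xs] by (simp add: step_def sums_iff)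
qed

lemma expect_round:
  "expect (fork_round xs) h =
    expect flag (\<lambda>fl. expect (offspring xs) (\<lambda>ys. expect (migration lam fork fl (map2 (select fork) xs ys)) h))"
  by (simp add: island_round_eq)

subsection \<open>The remaining time once the trap has been found\<close>

abbreviation "all_trap \<equiv> replicate lam trap"

lemma pmf_mutate_trap_opt: "pmf (mutate n trap) opt \<le> 1 / real n ^ (2 * r)"
proof -
  have "{i. i < n \<and> trap ! i \<noteq> opt ! i} = {..<r} \<union> {n - r..<n}"
    using two_r_le_n by (auto simp: nth_trap nth_opt)
  moreover have "card ({..<r} \<union> {n - r..<n}) = 2 * r"
    using two_r_le_n by (subst card_Un_disjoint) auto
  ultimately have "pmf (mutate n trap) opt =
      (1 / n) ^ (2 * r) * (1 - 1 / n) ^ card {i. i < n \<and> trap ! i = opt ! i}"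
    using n_ge_2 by (subst pmf_mutate) auto
  also have "\<dots> \<le> (1 / n) ^ (2 * r) * 1"
    using n_ge_2 by (intro mult_left_mono power_le_one) auto
  finally show ?thesis by (simp add: power_divide)
qed

lemma good_all_trap: "good all_trap"
  by (auto simp: good_def)

lemma remaining_all_trap: "ennreal (real n ^ (2 * r) / real lam) \<le> remaining all_trap"
proof -
  let ?P = "\<lambda>ys. opt \<in> set ys"
  let ?p = "expect (offspring all_trap) (\<lambda>ys. of_bool (\<not> ?P ys))"
  have n0: "real n ^ (2 * r) > 0" using n_ge_2 by simp
  have step: "of_bool (\<not> ?P ys) * remaining all_trap \<le>
      expect (migration lam fork fl (map2 (select fork) all_trap ys)) remaining"
    if ys: "ys \<in> set_pmf (offspring all_trap)" for ys fl
  proof (cases "?P ys")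
    case False
    have gy: "good ys" using offspring_good[OF good_all_trap ys] .
    let ?zs = "map2 (select fork) all_trap ys"
    have "trap \<in> set ?zs" "opt \<notin> set ?zs"
      using select_trap[OF good_all_trap _ gy _ False] lam_pos by auto
    moreover have gz: "good ?zs" using select_good[OF good_all_trap gy] .
    moreover have "?zs = all_trap"
    proof (rule nth_equalityI)
      show "length ?zs = length all_trap" using good_length[OF gz] by simp
      fix i assume "i < length ?zs"
      then have i: "i < lam" using good_length[OF gz] by simp
      have "ys ! i \<noteq> opt" using False i good_length[OF gy] by (metis nth_mem)
      then show "?zs ! i = all_trap ! i"
        using i nth_select[OF good_all_trap gy i, of fork] select_fork_from_trap[of "ys ! i"]
          good_nth[OF gy i] by simp
    qed
    ultimately show ?thesis
      using migration_trap[of ?zs] by (cases fl) (auto simp: migration_def)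
  qed simp
  have no: "\<not> has_opt n r all_trap" by (simp add: has_opt_iff)
  have "?p * remaining all_trap = expect flag (\<lambda>_. expect (offspring all_trap)
      (\<lambda>ys. of_bool (\<not> ?P ys) * remaining all_trap))"
    unfolding expect_const by (rule nn_integral_multc[symmetric]) auto
  also have "\<dots> \<le> expect (fork_round all_trap) remaining"
    unfolding expect_round by (intro expect_mono step)
  finally have rec: "?p * remaining all_trap + 1 \<le> remaining all_trap"
    unfolding remaining_unfold[OF no] by (rule add_right_mono)
  have "expect (offspring all_trap) (\<lambda>ys. of_bool (?P ys)) \<le> (\<Sum>i<lam. ennreal (1 / real n ^ (2 * r)))"
    using pmf_mutate_trap_opt
    by (intro order.trans[OF expect_mem_seq_pmf_le]) (auto intro!: mult_left_mono ennreal_leI)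
  also have "\<dots> = ennreal (lam / real n ^ (2 * r))"
    by (simp add: ennreal_of_nat_eq_real_of_nat ennreal_mult[symmetric])
  finally have q: "1 \<le> ennreal (lam / real n ^ (2 * r)) + ?p"
    using expect_of_bool_add_not[of "offspring all_trap" ?P] by (metis add_right_mono)
  show ?thesis
  proof (cases "remaining all_trap")
    case (real x)
    have "?p \<le> 1" using expect_of_bool_add_not[of "offspring all_trap" ?P]
      by (metis le_iff_add add.commute)
    then obtain p where p: "?p = ennreal p" "p \<ge> 0"
      using ennreal_cases[of ?p] by (metis ennreal_one_less_top not_le)
    have "p * x + 1 \<le> x" using rec p real
      by (simp add: ennreal_mult[symmetric] ennreal_1[symmetric] ennreal_plus[symmetric]
          del: ennreal_1 ennreal_plus)
    moreover have "1 - p \<le> lam / real n ^ (2 * r)" using q p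
      by (simp add: ennreal_1[symmetric] ennreal_plus[symmetric] del: ennreal_1 ennreal_plus)
    then have "(1 - p) * x \<le> lam / real n ^ (2 * r) * x" using real by (intro mult_right_mono) auto
    ultimately have "1 \<le> lam / real n ^ (2 * r) * x" by (simp add: algebra_simps)
    then have "real n ^ (2 * r) / lam \<le> x" using n0 lam_pos by (simp add: field_simps)
    then show ?thesis using real by (simp add: ennreal_leI)
  qed simp
qed

primrec avoid :: "nat \<Rightarrow> bool list list \<Rightarrow> ennreal" where
  "avoid 0 xs = of_bool (opt \<notin> set xs)"
| "avoid (Suc w) xs = of_bool (opt \<notin> set xs) *
     expect (offspring xs) (\<lambda>ys. avoid w (map2 (select fork) xs ys))"

lemma avoid_le_1: "avoid w xs \<le> 1"
proof (induction w arbitrary: xs)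
  case (Suc w)
  have "expect (offspring xs) (\<lambda>ys. avoid w (map2 (select fork) xs ys)) \<le> expect (offspring xs) (\<lambda>_. 1)"
    by (intro expect_mono Suc.IH)
  then show ?case by simp
qed simp

lemma avoid_opt: "opt \<in> set xs \<Longrightarrow> avoid w xs = 0"
  by (cases w) auto

lemma remaining_ge_avoid:
  assumes "good xs" "trap \<in> set xs"
  shows "remaining all_trap * ennreal (1 - (1 - 1 / tau) ^ w) * avoid w xs \<le> remaining xs"
  using assms
proof (induction w arbitrary: xs)
  case (Suc w)
  show ?case
  proof (cases "opt \<in> set xs")
    case False
    let ?R = "remaining all_trap" and ?z = "\<lambda>ys. map2 (select fork) xs ys"
    let ?t = "1 / real tau"
    have t: "0 \<le> ?t" "?t \<le> 1" using tau_pos by auto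
    have pw: "0 \<le> (1 - ?t) ^ w" "(1 - ?t) ^ w \<le> 1" using t by (auto intro!: power_le_one)
    have case_z: "trap \<in> set (?z ys)" "good (?z ys)"
      if "ys \<in> set_pmf (offspring xs)" "opt \<notin> set (?z ys)" for ys
    proof -
      have gy: "good ys" using offspring_good[OF Suc.prems(1) that(1)] .
      show "good (?z ys)" using select_good[OF Suc.prems(1) gy] .
      have "opt \<notin> set ys"
      proof
        assume "opt \<in> set ys"
        then obtain i where i: "i < lam" "ys ! i = opt"
          using good_length[OF gy] by (auto simp: in_set_conv_nth)
        then have "?z ys ! i = opt"
          using nth_select[OF Suc.prems(1) gy i(1), of fork] select_fork_opt
            good_nth[OF Suc.prems(1) i(1)] by simp
        then show False using that(2) i(1) good_length[OF \<open>good (?z ys)\<close>] by (metis nth_mem)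
      qed
      then show "trap \<in> set (?z ys)" using select_trap[OF Suc.prems(1) False gy] Suc.prems by auto
    qed
    have T: "?R * avoid w (?z ys) \<le> expect (migration lam fork True (?z ys)) remaining"
      if "ys \<in> set_pmf (offspring xs)" for ys
    proof (cases "opt \<in> set (?z ys)")
      case no: False
      have "?R * avoid w (?z ys) \<le> ?R * 1" by (intro mult_left_mono avoid_le_1) auto
      then show ?thesis using migration_trap[OF case_z(2,1)[OF that no] no] by simp
    qed (simp add: avoid_opt)
    have F: "?R * ennreal (1 - (1 - ?t) ^ w) * avoid w (?z ys) \<le>
        expect (migration lam fork False (?z ys)) remaining"
      if "ys \<in> set_pmf (offspring xs)" for ys
    proof (cases "opt \<in> set (?z ys)")
      case no: False
      show ?thesis using Suc.IH[OF case_z(2,1)[OF that no]] by (simp add: migration_def)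
    qed (simp add: avoid_opt)
    have *: "1 - (1 - ?t) ^ Suc w = ?t + (1 - (1 - ?t) ^ w) * (1 - ?t)" by (simp add: algebra_simps)
    have **: "ennreal (1 - (1 - ?t) ^ Suc w) = ennreal ?t + ennreal (1 - (1 - ?t) ^ w) * ennreal (1 - ?t)"
      unfolding * using t pw by (subst ennreal_plus) (auto simp: ennreal_mult)
    have "?R * ennreal (1 - (1 - ?t) ^ Suc w) * avoid (Suc w) xs =
        expect (offspring xs) (\<lambda>ys. ?R * avoid w (?z ys)) * ennreal ?t +
        expect (offspring xs) (\<lambda>ys. ?R * ennreal (1 - (1 - ?t) ^ w) * avoid w (?z ys)) * ennreal (1 - ?t)"
      unfolding ** using False by (simp add: nn_integral_cmult algebra_simps)
    also have "\<dots> \<le> expect (fork_round xs) remaining"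
      unfolding expect_round expect_flag by (intro add_mono mult_right_mono expect_mono T F) auto
    also have "\<dots> \<le> remaining xs" using remaining_unfold[of xs] False by (simp add: has_opt_iff)
    finally show ?thesis .
  qed (simp add: avoid_opt)
qed simp

primrec hit :: "nat \<Rightarrow> bool list \<Rightarrow> ennreal" where
  "hit 0 x = of_bool (x = opt)"
| "hit (Suc w) x = expect (mutate n x) (\<lambda>y. hit w (select fork x y))"

lemma hit_opt: "hit w opt = 1"
proof (induction w)
  case (Suc w)
  have "hit (Suc w) opt = expect (mutate n opt) (\<lambda>_. 1)"
    unfolding hit.simps using length_mutate[of _ n opt]
    by (intro expect_cong) (simp add: select_fork_from_opt Suc.IH)
  then show ?case by simp
qed simp

lemma hit_trap: "hit w trap \<le> ennreal (real w / real n ^ (2 * r))"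
proof (induction w)
  case (Suc w)
  have "hit (Suc w) trap \<le> expect (mutate n trap) (\<lambda>y. of_bool (y = opt) + hit w trap)"
    unfolding hit.simps using length_mutate[of _ n trap]
    by (intro expect_mono) (auto simp: select_fork_from_trap hit_opt)
  also have "\<dots> = ennreal (pmf (mutate n trap) opt) + hit w trap"
    by (subst nn_integral_add) (auto simp: expect_of_bool_eq)
  also have "\<dots> \<le> ennreal (1 / real n ^ (2 * r)) + ennreal (real w / real n ^ (2 * r))"
    by (intro add_mono Suc.IH ennreal_leI pmf_mutate_trap_opt)
  also have "\<dots> = ennreal (real (Suc w) / real n ^ (2 * r))"
    by (subst ennreal_plus[symmetric]) (auto simp: add_divide_distrib)
  finally show ?case .
qed simp

lemma avoid_hit:
  assumes "good xs"
  shows "1 \<le> avoid w xs + (\<Sum>j<lam. hit w (xs ! j))"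
proof -
  have opt: "1 \<le> avoid w xs + (\<Sum>j<lam. hit w (xs ! j))" if x: "opt \<in> set xs" "good xs" for w xs
  proof -
    obtain j where j: "j < lam" "xs ! j = opt"
      using x good_length[OF x(2)] by (auto simp: in_set_conv_nth)
    then have "1 \<le> (\<Sum>j<lam. hit w (xs ! j))"
      using member_le_sum[of j "{..<lam}" "\<lambda>j. hit w (xs ! j)"] by (simp add: hit_opt)
    then show ?thesis by (simp add: add_increasing)
  qed
  show ?thesis using assms
  proof (induction w arbitrary: xs)
    case (Suc w)
    show ?case
    proof (cases "opt \<in> set xs")
      case False
      let ?z = "\<lambda>ys. map2 (select fork) xs ys"
      have "1 = expect (offspring xs) (\<lambda>_. 1)" by simp
      also have "\<dots> \<le> expect (offspring xs)
          (\<lambda>ys. avoid w (?z ys) + (\<Sum>j<lam. hit w (select fork (xs ! j) (ys ! j))))"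
      proof (rule expect_mono)
        fix ys assume "ys \<in> set_pmf (offspring xs)"
        then have gy: "good ys" using offspring_good[OF Suc.prems] by blast
        show "1 \<le> avoid w (?z ys) + (\<Sum>j<lam. hit w (select fork (xs ! j) (ys ! j)))"
          using Suc.IH[OF select_good[OF Suc.prems gy]] nth_select[OF Suc.prems gy]
          by (simp del: nth_map nth_zip)
      qed
      also have "\<dots> = avoid (Suc w) xs +
          (\<Sum>j<lam. expect (offspring xs) (\<lambda>ys. hit w (select fork (xs ! j) (ys ! j))))"
        using False by (subst nn_integral_add) (auto simp: nn_integral_sum)
      also have "\<dots> = avoid (Suc w) xs + (\<Sum>j<lam. hit (Suc w) (xs ! j))"
        using good_length[OF Suc.prems]
        by (simp add: expect_nth_seq_pmf[where f = "\<lambda>y. hit w (select fork _ y)"] del: avoid.simps)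
      finally show ?thesis .
    qed (use opt Suc.prems in blast)
  next
    case (0 xs)
    show ?case
    proof (cases "opt \<in> set xs")
      case True
      then show ?thesis using opt 0 by blast
    qed simp
  qed
qed

primrec ea_offspring :: "nat \<Rightarrow> bool list \<Rightarrow> bool list pmf" where
  "ea_offspring 0 x = mutate n x"
| "ea_offspring (Suc k) x = bind_pmf (mutate n x) (\<lambda>y. ea_offspring k (select ones x y))"

lemma hit_select_le:
  assumes "length x = n" "x \<noteq> trap" "x \<noteq> opt" "length y = n"
  shows "hit w (select fork x y) \<le> of_bool (y = opt) +
    ((\<Sum>k<w. ennreal (pmf (ea_offspring k (select ones x y)) opt)) + ennreal (real w / real n ^ (2 * r)))"
  using assms
proof (induction w arbitrary: x y)
  case 0
  then show ?case by (simp add: select_fork_opt_iff)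
next
  case (Suc w)
  consider "y = opt" | "y = trap" | "y \<noteq> opt" "y \<noteq> trap" by blast
  then show ?case
  proof cases
    case 1
    then show ?thesis using Suc.prems by (simp add: select_fork_opt hit_opt del: hit.simps)
  next
    case 2
    then have "hit (Suc w) (select fork x y) \<le> ennreal (real (Suc w) / real n ^ (2 * r))"
      using hit_trap[of "Suc w"] Suc.prems by (simp add: select_fork_trap del: hit.simps of_nat_Suc)
    then show ?thesis by (rule order.trans) (auto intro!: add_increasing)
  next
    case 3
    define z where "z = select ones x y"
    have z: "select fork x y = z" "z \<noteq> trap" "z \<noteq> opt" "length z = n"
      using Suc.prems 3 select_fork_other[of x y] by (auto simp: z_def) (auto simp: select_def)
    have "hit (Suc w) z \<le> expect (mutate n z) (\<lambda>y. of_bool (y = opt) +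
        ((\<Sum>k<w. ennreal (pmf (ea_offspring k (select ones z y)) opt)) + ennreal (real w / real n ^ (2 * r))))"
      unfolding hit.simps using length_mutate[of _ n z] z by (intro expect_mono Suc.IH) auto
    also have "\<dots> = ennreal (pmf (ea_offspring 0 z) opt) +
        ((\<Sum>k<w. ennreal (pmf (ea_offspring (Suc k) z) opt)) + ennreal (real w / real n ^ (2 * r)))"
      by (simp add: nn_integral_add nn_integral_sum expect_of_bool_eq ennreal_pmf_bind del: sum_ennreal)
    also have "\<dots> = (\<Sum>k<Suc w. ennreal (pmf (ea_offspring k z) opt)) + ennreal (real w / real n ^ (2 * r))"
      by (simp only: sum.lessThan_Suc_shift add.assoc)
    also have "\<dots> \<le> (\<Sum>k<Suc w. ennreal (pmf (ea_offspring k z) opt)) + ennreal (real (Suc w) / real n ^ (2 * r))"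
      by (intro add_left_mono ennreal_leI divide_right_mono) auto
    finally show ?thesis using 3 z by (simp add: z_def[symmetric] del: hit.simps)
  qed
qed

subsection \<open>The process before the trap or the optimum is found\<close>

text \<open>As a functional, \<open>mu s\<close> is the law of the state after \<open>s\<close> rounds on the event that no island has
  held the trap or the optimum. On that event \<^const>\<open>Fork\<close> agrees with \<^const>\<open>ones\<close>, so the kernel is
  written with \<^const>\<open>ones\<close>, whose unkilled process \<open>nu\<close> commutes with permutations of the bit
  positions.\<close>

definition kill :: "bool list list \<Rightarrow> (bool list list \<Rightarrow> ennreal) \<Rightarrow> ennreal" where
  "kill xs h = expect flag (\<lambda>fl. expect (offspring xs) (\<lambda>ys.
     of_bool (trap \<notin> set ys \<and> opt \<notin> set ys) *
     expect (migration lam ones fl (map2 (select ones) xs ys)) h))"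

primrec mu :: "nat \<Rightarrow> (bool list list \<Rightarrow> ennreal) \<Rightarrow> ennreal" where
  "mu 0 = (\<lambda>h. expect (island_init n lam) (\<lambda>xs. of_bool (clean xs) * h xs))"
| "mu (Suc s) = (\<lambda>h. mu s (\<lambda>xs. kill xs h))"

lemma kill_support:
  assumes "clean xs" "ys \<in> set_pmf (offspring xs)" "trap \<notin> set ys \<and> opt \<notin> set ys"
    "ws \<in> set_pmf (migration lam f fl (map2 (select g) xs ys))"
  shows "clean ws"
proof -
  have "clean ys" using assms(3) offspring_good[OF clean_good[OF assms(1)] assms(2)]
    by (simp add: clean_def)
  from migration_clean[OF select_clean(2)[OF assms(1) this] assms(4)] show ?thesis .
qed

lemma kill_mono:
  assumes "clean xs" "\<And>ws. clean ws \<Longrightarrow> h ws \<le> g ws"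
  shows "kill xs h \<le> kill xs g"
  unfolding kill_def using kill_support[OF assms(1)] assms(2)
  by (intro expect_mono) (auto intro!: expect_mono mult_left_mono)

lemma mu_mono:
  assumes "\<And>xs. clean xs \<Longrightarrow> h xs \<le> g xs"
  shows "mu s h \<le> mu s g"
  using assms
proof (induction s arbitrary: h g)
  case 0
  then show ?case by (auto intro!: expect_mono)
next
  case (Suc s)
  show ?case unfolding mu.simps by (rule Suc.IH) (auto intro!: kill_mono Suc.prems)
qed

lemma mu_cong: "(\<And>xs. clean xs \<Longrightarrow> h xs = g xs) \<Longrightarrow> mu s h = mu s g"
  by (intro order.antisym mu_mono) auto

lemma mu_add: "mu s (\<lambda>xs. h xs + g xs) = mu s h + mu s g"
  by (induction s arbitrary: h g)
    (auto simp: kill_def nn_integral_add distrib_left)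

lemma mu_cmult: "mu s (\<lambda>xs. c * h xs) = c * mu s h"
proof (induction s arbitrary: h)
  case 0
  then show ?case by (simp add: nn_integral_cmult[symmetric] mult.left_commute)
next
  case (Suc s)
  have "kill xs (\<lambda>xs. c * h xs) = c * kill xs h" for xs
    unfolding kill_def by (simp add: nn_integral_cmult mult.left_commute)
  then show ?case using Suc.IH by simp
qed

lemma mu_sum: "finite A \<Longrightarrow> mu s (\<lambda>xs. \<Sum>a\<in>A. h a xs) = (\<Sum>a\<in>A. mu s (h a))"
proof (induction A rule: finite_induct)
  case empty
  show ?case using mu_cmult[of s 0 "\<lambda>_. 0"] by simp
next
  case (insert a A)
  then show ?case using mu_add[of s "h a" "\<lambda>xs. \<Sum>a\<in>A. h a xs"] by simp
qed

primrec nu :: "nat \<Rightarrow> bool list list pmf" where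
  "nu 0 = island_init n lam"
| "nu (Suc s) = bind_pmf (nu s) (island_round n ones tau (complete_nbrs lam))"

lemma mu_le_nu: "mu s h \<le> expect (nu s) h"
proof (induction s arbitrary: h)
  case 0
  show ?case by (auto intro!: nn_integral_mono simp: of_bool_def)
next
  case (Suc s)
  have "mu (Suc s) h \<le> expect (nu s) (\<lambda>xs. kill xs h)" using Suc.IH by simp
  also have "\<dots> \<le> expect (nu (Suc s)) h"
    unfolding nu.simps nn_integral_bind_pmf island_round_eq kill_def
    by (intro nn_integral_mono) (auto simp: of_bool_def)
  finally show ?case .
qed

lemma uniform_bits_support: "set_pmf (uniform_bits n) = {x. length x = n}"
  and finite_bits: "finite {x :: bool list. length x = n}"
  and bits_nonempty: "{x :: bool list. length x = n} \<noteq> {}"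
proof -
  show 1: "finite {x :: bool list. length x = n}"
    using finite_lists_length_eq[of "UNIV :: bool set" n] by simp
  have "replicate n True \<in> {x :: bool list. length x = n}" by simp
  then show 2: "{x :: bool list. length x = n} \<noteq> {}" by blast
  show "set_pmf (uniform_bits n) = {x. length x = n}"
    unfolding uniform_bits_def using set_pmf_of_set[OF 2 1] .
qed

lemma init_good: "xs \<in> set_pmf (island_init n lam) \<Longrightarrow> good xs"
  using nth_seq_pmf[of xs "replicate lam (uniform_bits n)"] length_seq_pmf[of xs "replicate lam (uniform_bits n)"]
  by (intro goodI) (auto simp: island_init_def uniform_bits_support)

lemma nu_good: "xs \<in> set_pmf (nu s) \<Longrightarrow> good xs"
proof (induction s arbitrary: xs)
  case (Suc s)
  then obtain xs' fl ys where "xs' \<in> set_pmf (nu s)" "ys \<in> set_pmf (offspring xs')"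
    "xs \<in> set_pmf (migration lam ones fl (map2 (select ones) xs' ys))"
    by (auto simp: island_round_eq)
  with Suc.IH show ?case using migration_good select_good offspring_good by blast
qed (simp add: init_good)

context
  fixes \<pi> :: "nat \<Rightarrow> nat"
  assumes \<pi>: "\<pi> permutes {..<n}"
begin

abbreviation "act \<equiv> permute_list \<pi> :: bool list \<Rightarrow> bool list"

lemma act_mutate: "length x = n \<Longrightarrow> mutate n (act x) = map_pmf act (mutate n x)"
  using mutate_permute_list \<pi> by simp

lemma act_select: "length x = n \<Longrightarrow> length y = n \<Longrightarrow> select ones (act x) (act y) = act (select ones x y)"
  using ones_permute_list \<pi> by (simp add: select_def)

lemma act_offspring:
  assumes "good xs"
  shows "offspring (map act xs) = map_pmf (map act) (offspring xs)"
proof -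
  have "map (mutate n) (map act xs) = map (map_pmf act) (map (mutate n) xs)"
    using assms act_mutate by (simp add: good_def)
  then show ?thesis by (simp only: map_pmf_map_seq_pmf)
qed

lemma act_select_map2:
  assumes "good xs" "good ys"
  shows "map2 (select ones) (map act xs) (map act ys) = map act (map2 (select ones) xs ys)"
  using assms act_select good_nth[OF assms(1)] good_nth[OF assms(2)]
  by (intro nth_equalityI) (auto simp: good_length)

lemma act_migration:
  "good zs \<Longrightarrow> migration lam ones fl (map act zs) = map_pmf (map act) (migration lam ones fl zs)"
  using ones_permute_list \<pi> by (intro migration_map) (auto simp: good_def)

lemma act_ea_offspring:
  "length x = n \<Longrightarrow> ea_offspring k (act x) = map_pmf act (ea_offspring k x)"
proof (induction k arbitrary: x)
  case (Suc k)
  have "bind_pmf (mutate n x) (\<lambda>y. ea_offspring k (select ones (act x) (act y))) =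
      bind_pmf (mutate n x) (\<lambda>y. map_pmf act (ea_offspring k (select ones x y)))"
  proof (rule bind_pmf_cong[OF refl])
    fix y assume "y \<in> set_pmf (mutate n x)"
    then have "length y = n" using length_mutate Suc.prems by metis
    then show "ea_offspring k (select ones (act x) (act y)) = map_pmf act (ea_offspring k (select ones x y))"
      using act_select[OF Suc.prems] Suc.IH[of "select ones x y"] Suc.prems by (simp add: select_def)
  qed
  then show ?case by (simp add: act_mutate[OF Suc.prems] bind_map_pmf map_bind_pmf)
qed (simp add: act_mutate)

lemma act_uniform_bits: "map_pmf act (uniform_bits n) = uniform_bits n"
proof -
  let ?A = "{x :: bool list. length x = n}"
  have inj: "inj_on act ?A" using inj_on_permute_list[OF \<pi>] .
  have "act ` ?A = ?A"
    by (rule card_subset_eq[OF finite_bits]) (auto simp: card_image[OF inj])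
  then show ?thesis
    using map_pmf_of_set_inj[OF inj bits_nonempty finite_bits] by (simp add: uniform_bits_def)
qed

lemma act_init: "map_pmf (map act) (island_init n lam) = island_init n lam"
  by (simp add: island_init_def map_pmf_map_seq_pmf act_uniform_bits)

lemma act_round:
  assumes "good xs"
  shows "island_round n ones tau (complete_nbrs lam) (map act xs) =
    map_pmf (map act) (island_round n ones tau (complete_nbrs lam) xs)"
proof -
  have "bind_pmf (offspring xs) (\<lambda>ys. migration lam ones fl (map2 (select ones) (map act xs) (map act ys))) =
      bind_pmf (offspring xs) (\<lambda>ys. map_pmf (map act) (migration lam ones fl (map2 (select ones) xs ys)))" for fl
    using offspring_good[OF assms] assms
    by (intro bind_pmf_cong refl) (simp only: act_select_map2 act_migration select_good)
  then show ?thesis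
    by (simp only: island_round_eq act_offspring[OF assms] bind_map_pmf map_bind_pmf)
qed

lemma act_nu: "map_pmf (map act) (nu s) = nu s"
proof (induction s)
  case (Suc s)
  have "map_pmf (map act) (nu (Suc s)) =
      bind_pmf (nu s) (\<lambda>xs. map_pmf (map act) (island_round n ones tau (complete_nbrs lam) xs))"
    by (simp add: map_bind_pmf)
  also have "\<dots> = bind_pmf (nu s) (\<lambda>xs. island_round n ones tau (complete_nbrs lam) (map act xs))"
    by (intro bind_pmf_cong refl) (simp add: act_round nu_good)
  also have "\<dots> = bind_pmf (map_pmf (map act) (nu s)) (island_round n ones tau (complete_nbrs lam))"
    by (simp add: bind_map_pmf)
  finally show ?case using Suc.IH by simp
qed (simp add: act_init)

end

lemma ea_offspring_length: "y \<in> set_pmf (ea_offspring k x) \<Longrightarrow> length x = n \<Longrightarrow> length y = n"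
proof (induction k arbitrary: x)
  case (Suc k)
  then obtain z where z: "z \<in> set_pmf (mutate n x)" "y \<in> set_pmf (ea_offspring k (select ones x z))"
    by auto
  then have "length (select ones x z) = n"
    using length_mutate[OF z(1)] Suc.prems by (simp add: select_def)
  then show ?case using Suc.IH z by blast
qed (simp add: length_mutate)

lemma zip_trap_opt:
  "zip trap opt = replicate r (False, True) @ replicate (n - 2 * r) (True, True) @ replicate r (True, False)"
  "zip opt trap = replicate r (True, False) @ replicate (n - 2 * r) (True, True) @ replicate r (False, True)"
  using two_r_le_n by (auto intro!: nth_equalityI simp: nth_trap nth_opt nth_append)

lemma card_orbit_trap: "(real n / real r) ^ r \<le> card (permutations_of_multiset (mset trap))"
proof -
  let ?c = "card (permutations_of_multiset (mset trap))"
  have m: "mset trap = replicate_mset r False + replicate_mset (n - r) True"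
    by (simp add: fork_trap_def)
  have "set_mset (mset trap) = {False, True}"
    using r_pos two_r_le_n unfolding m by auto
  then have "(\<Prod>x\<in>set_mset (mset trap). fact (count (mset trap) x)) = (fact r * fact (n - r) :: nat)"
    unfolding m by simp
  then have "?c * (fact r * fact (n - r)) = fact n"
    using card_permutations_of_multiset_aux[of "mset trap"] by simp
  also have "fact n = (n choose r) * (fact r * fact (n - r))"
    using binomial_fact_lemma[of r n] two_r_le_n by (simp add: algebra_simps)
  finally have "?c = n choose r" by simp
  then show ?thesis
    using binomial_ge_n_over_k_pow_k[of r n, where ?'a = real] two_r_le_n by simp
qed

lemma card_orbit_trap_opt:
  "(real n / real (2 * r)) ^ (2 * r) \<le> card (permutations_of_multiset (mset (zip trap opt)))"
proof -
  let ?m = "mset (zip trap opt)"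
  let ?c = "card (permutations_of_multiset ?m)"
  let ?A = "{(False, True), (True, True), (True, False)}"
  have m: "?m = replicate_mset r (False, True) + replicate_mset (n - 2 * r) (True, True) +
      replicate_mset r (True, False)"
    by (simp add: zip_trap_opt)
  have "(\<Prod>x\<in>set_mset ?m. fact (count ?m x)) = (\<Prod>x\<in>?A. fact (count ?m x) :: nat)"
  proof (rule prod.mono_neutral_left)
    show "set_mset ?m \<subseteq> ?A" unfolding m by (auto split: if_splits)
    show "\<forall>x\<in>?A - set_mset ?m. fact (count ?m x) = (1 :: nat)"
    proof
      fix x assume "x \<in> ?A - set_mset ?m"
      then have "count ?m x = 0" by (simp only: Diff_iff not_in_iff)
      then show "fact (count ?m x) = (1 :: nat)" by (simp only: fact_0)
    qed
  qed simp
  also have "\<dots> = fact r * fact (n - 2 * r) * fact r" unfolding m by simp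
  finally have "?c * (fact r * fact (n - 2 * r) * fact r) = fact n"
    using card_permutations_of_multiset_aux[of ?m] by simp
  also have "fact n = (n choose (2 * r)) * (fact (2 * r) * fact (n - 2 * r))"
    using binomial_fact_lemma[of "2 * r" n] two_r_le_n by (simp add: algebra_simps)
  also have "fact (2 * r) = (2 * r choose r) * (fact r * fact r)"
    using binomial_fact_lemma[of r "2 * r"] by (simp add: algebra_simps)
  finally have "?c * (fact r * fact r * fact (n - 2 * r)) =
      (n choose (2 * r)) * (2 * r choose r) * (fact r * fact r * fact (n - 2 * r))"
    by (simp add: algebra_simps)
  then have "?c = (n choose (2 * r)) * (2 * r choose r)" by simp
  moreover have "(2 * r choose r) \<ge> 1" by (simp add: Suc_le_eq)
  ultimately have "n choose (2 * r) \<le> ?c" by simp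
  then have "real (n choose (2 * r)) \<le> real ?c" by simp
  then show ?thesis
    using binomial_ge_n_over_k_pow_k[of "2 * r" n, where ?'a = real] two_r_le_n by linarith
qed

lemma mset_opt: "mset opt = mset trap"
  by (simp add: fork_trap_def fork_opt_def)

lemma pmf_invariant_special_le:
  assumes "\<And>\<pi>. \<pi> permutes {..<n} \<Longrightarrow> map_pmf (permute_list \<pi>) p = p"
    and "\<And>y. y \<in> set_pmf p \<Longrightarrow> length y = n" and "y = trap \<or> y = opt"
  shows "pmf p y \<le> real r ^ r / real n ^ r"
proof -
  have "length y = n" "mset y = mset trap" using assms(3) mset_opt by auto
  then have "pmf p y \<le> 1 / card (permutations_of_multiset (mset trap))"
    using pmf_permutation_invariant_le[of n p y] assms(1,2) by simp
  also have "\<dots> \<le> 1 / (real n / real r) ^ r"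
    using card_orbit_trap n_ge_2 r_pos
    by (intro divide_left_mono) (auto intro!: mult_pos_pos elim: less_le_trans[rotated])
  finally show ?thesis by (simp add: power_divide)
qed

lemma expect_nu_special:
  assumes "i < lam" "y = trap \<or> y = opt"
  shows "expect (nu s) (\<lambda>xs. ennreal (pmf (mutate n (xs ! i)) y)) \<le> ennreal (real r ^ r / real n ^ r)"
proof -
  define p where "p = bind_pmf (nu s) (\<lambda>xs. mutate n (xs ! i))"
  have "map_pmf (permute_list \<pi>) p = p" if \<pi>: "\<pi> permutes {..<n}" for \<pi>
  proof -
    have "map_pmf (permute_list \<pi>) p = bind_pmf (nu s) (\<lambda>xs. map_pmf (permute_list \<pi>) (mutate n (xs ! i)))"
      by (simp add: p_def map_bind_pmf)
    also have "\<dots> = bind_pmf (nu s) (\<lambda>xs. mutate n (map (permute_list \<pi>) xs ! i))"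
      using assms by (intro bind_pmf_cong refl) (auto dest!: nu_good simp: act_mutate[OF \<pi>] good_nth good_length)
    also have "\<dots> = bind_pmf (map_pmf (map (permute_list \<pi>)) (nu s)) (\<lambda>xs. mutate n (xs ! i))"
      by (simp add: bind_map_pmf)
    finally show ?thesis using act_nu[OF \<pi>] by (simp add: p_def)
  qed
  moreover have "length y = n" if "y \<in> set_pmf p" for y
    using that assms by (auto simp: p_def dest!: nu_good length_mutate simp: good_nth)
  ultimately have "pmf p y \<le> real r ^ r / real n ^ r"
    using assms(2) by (intro pmf_invariant_special_le)
  then show ?thesis by (simp add: p_def ennreal_pmf_bind[symmetric] ennreal_leI)
qed

lemma expect_nu_pair:
  assumes "i < lam" "j < lam"
  shows "expect (nu s) (\<lambda>xs. ennreal (pmf (mutate n (xs ! i)) trap) * ennreal (pmf (ea_offspring k (xs ! j)) opt))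
    \<le> ennreal (real (2 * r) ^ (2 * r) / real n ^ (2 * r))"
proof -
  define f where "f = (\<lambda>(x :: bool list, y :: bool list). zip x y)"
  define q where "q = (\<lambda>xs. pair_pmf (mutate n (xs ! i)) (ea_offspring k (xs ! j)))"
  define p where "p = bind_pmf (nu s) (\<lambda>xs. map_pmf f (q xs))"
  have q_len: "length x = n \<and> length y = n" if "xs \<in> set_pmf (nu s)" "(x, y) \<in> set_pmf (q xs)" for x y xs
    using that assms good_nth[OF nu_good[OF that(1)]]
    by (auto simp: q_def dest!: length_mutate ea_offspring_length)
  have "map_pmf (permute_list \<pi>) p = p" if \<pi>: "\<pi> permutes {..<n}" for \<pi>
  proof -
    have "map_pmf (permute_list \<pi>) (map_pmf f (q xs)) = map_pmf f (q (map (permute_list \<pi>) xs))"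
      if xs: "xs \<in> set_pmf (nu s)" for xs
    proof -
      have "map_pmf (permute_list \<pi>) (map_pmf f (q xs)) =
          map_pmf (\<lambda>z. f (map_prod (permute_list \<pi>) (permute_list \<pi>) z)) (q xs)"
        unfolding map_pmf_comp
        by (intro map_pmf_cong refl)
          (use \<pi> q_len[OF xs] in \<open>auto simp: f_def intro!: permute_list_zip\<close>)
      also have "\<dots> = map_pmf f (map_pmf (map_prod (permute_list \<pi>) (permute_list \<pi>)) (q xs))"
        by (simp add: map_pmf_comp)
      also have "map_pmf (map_prod (permute_list \<pi>) (permute_list \<pi>)) (q xs) = q (map (permute_list \<pi>) xs)"
        using assms nu_good[OF xs] act_mutate[OF \<pi>] act_ea_offspring[OF \<pi>]
        by (simp add: q_def map_prod_def map_pair good_nth good_length)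
      finally show ?thesis .
    qed
    then have "map_pmf (permute_list \<pi>) p = bind_pmf (nu s) (\<lambda>xs. map_pmf f (q (map (permute_list \<pi>) xs)))"
      unfolding p_def map_bind_pmf by (intro bind_pmf_cong refl)
    also have "\<dots> = bind_pmf (map_pmf (map (permute_list \<pi>)) (nu s)) (\<lambda>xs. map_pmf f (q xs))"
      by (simp add: bind_map_pmf)
    finally show ?thesis using act_nu[OF \<pi>] by (simp add: p_def)
  qed
  moreover have "length y = n" if "y \<in> set_pmf p" for y
    using that q_len by (fastforce simp: p_def f_def)
  ultimately have le: "pmf p (zip trap opt) \<le> 1 / card (permutations_of_multiset (mset (zip trap opt)))"
    by (intro pmf_permutation_invariant_le[of n]) auto
  have "expect (nu s) (\<lambda>xs. ennreal (pmf (mutate n (xs ! i)) trap) * ennreal (pmf (ea_offspring k (xs ! j)) opt))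
      = expect (nu s) (\<lambda>xs. ennreal (pmf (q xs) (trap, opt)))"
    by (simp add: q_def pmf_pair ennreal_mult)
  also have "\<dots> \<le> expect (nu s) (\<lambda>xs. ennreal (pmf (map_pmf f (q xs)) (f (trap, opt))))"
    by (intro nn_integral_mono ennreal_leI pmf_le_pmf_map)
  also have "\<dots> = ennreal (pmf p (zip trap opt))"
    by (simp add: p_def ennreal_pmf_bind f_def)
  also have "\<dots> \<le> ennreal (1 / (real n / real (2 * r)) ^ (2 * r))"
    using card_orbit_trap_opt n_ge_2 r_pos
    by (intro ennreal_leI order.trans[OF le] divide_left_mono) (auto intro!: mult_pos_pos elim: less_le_trans[rotated])
  finally show ?thesis by (simp add: power_divide)
qed

lemma mem_map_swap:
  assumes "\<pi> permutes {..<n}" "permute_list \<pi> trap = opt" "permute_list \<pi> opt = trap" "good ys"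
  shows "trap \<in> set (map (permute_list \<pi>) ys) \<longleftrightarrow> opt \<in> set ys"
    "opt \<in> set (map (permute_list \<pi>) ys) \<longleftrightarrow> trap \<in> set ys"
  using mem_map_permute_list[OF assms(1) _ length_opt assms(3)]
    mem_map_permute_list[OF assms(1) _ length_trap assms(2)] assms(4)
  unfolding good_def by blast+

lemma mu_swap:
  obtains \<pi> where "\<pi> permutes {..<n}" "permute_list \<pi> trap = opt" "permute_list \<pi> opt = trap"
    "\<And>s h. mu s (\<lambda>xs. h (map (permute_list \<pi>) xs)) = mu s h"
proof -
  have "mset (zip opt trap) = mset (zip trap opt)" by (simp add: zip_trap_opt)
  from mset_eq_permutation[OF this] obtain \<pi>
    where *: "\<pi> permutes {..<length (zip trap opt)}" "permute_list \<pi> (zip trap opt) = zip opt trap"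
    by blast
  then have \<pi>: "\<pi> permutes {..<n}" by simp
  let ?a = "permute_list \<pi> :: bool list \<Rightarrow> bool list"
  have "zip (?a trap) (?a opt) = zip opt trap"
    using *(2) permute_list_zip[OF \<pi>, of trap opt] by simp
  then have a: "?a trap = opt" "?a opt = trap"
    by (metis length_opt length_permute_list length_trap map_fst_zip,
        metis length_opt length_permute_list length_trap map_snd_zip)
  note mem = mem_map_swap[OF \<pi> a]
  have cl: "clean (map ?a xs) \<longleftrightarrow> clean xs" if "good xs" for xs
    using mem[OF that] that by (auto simp: clean_def good_def)
  have kill: "kill (map ?a xs) h = kill xs (\<lambda>ws. h (map ?a ws))" if xs: "good xs" for xs h
    unfolding kill_def act_offspring[OF \<pi> xs] nn_integral_map_pmf
    using offspring_good[OF xs]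
    by (intro expect_cong)
      (simp only: mem act_select_map2[OF \<pi> xs] act_migration[OF \<pi>] select_good[OF xs]
        nn_integral_map_pmf conj_commute)
  have "mu s (\<lambda>xs. h (map ?a xs)) = mu s h" for s h
  proof (induction s arbitrary: h)
    case 0
    have "mu 0 h = expect (map_pmf (map ?a) (island_init n lam)) (\<lambda>xs. of_bool (clean xs) * h xs)"
      using act_init[OF \<pi>] by simp
    also have "\<dots> = mu 0 (\<lambda>xs. h (map ?a xs))"
      using cl[OF init_good] by (auto intro!: expect_cong)
    finally show ?case by simp
  next
    case (Suc s)
    have "mu (Suc s) (\<lambda>xs. h (map ?a xs)) = mu s (\<lambda>xs. kill (map ?a xs) h)"
      using kill[OF clean_good] by (auto intro!: mu_cong)
    then show ?case using Suc.IH[of "\<lambda>xs. kill xs h"] by simp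
  qed
  with \<pi> a that show ?thesis by blast
qed

lemma mu_offspring_swap:
  "mu s (\<lambda>xs. expect (offspring xs) (\<lambda>ys. of_bool (trap \<in> set ys \<and> opt \<notin> set ys))) =
   mu s (\<lambda>xs. expect (offspring xs) (\<lambda>ys. of_bool (opt \<in> set ys \<and> trap \<notin> set ys)))"
proof (rule mu_swap)
  fix \<pi> assume \<pi>: "\<pi> permutes {..<n}" and a: "permute_list \<pi> trap = opt" "permute_list \<pi> opt = trap"
    and inv: "\<And>s h. mu s (\<lambda>xs. h (map (permute_list \<pi>) xs)) = mu s h"
  let ?a = "permute_list \<pi> :: bool list \<Rightarrow> bool list"
  let ?h = "\<lambda>xs. expect (offspring xs) (\<lambda>ys. of_bool (trap \<in> set ys \<and> opt \<notin> set ys) :: ennreal)"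
  note mem = mem_map_swap[OF \<pi> a]
  have "mu s ?h = mu s (\<lambda>xs. ?h (map ?a xs))" by (rule inv[symmetric])
  also have "\<dots> = mu s (\<lambda>xs. expect (offspring xs) (\<lambda>ys. of_bool (opt \<in> set ys \<and> trap \<notin> set ys)))"
  proof (rule mu_cong)
    fix xs assume xs: "clean xs"
    show "?h (map ?a xs) = expect (offspring xs) (\<lambda>ys. of_bool (opt \<in> set ys \<and> trap \<notin> set ys))"
      unfolding act_offspring[OF \<pi> clean_good[OF xs]] nn_integral_map_pmf
      using offspring_good[OF clean_good[OF xs]] by (intro expect_cong) (simp only: mem)
  qed
  finally show ?thesis .
qed

subsection \<open>Decomposition of the expected time\<close>

definition theta :: "nat \<Rightarrow> ennreal" where
  "theta w = remaining all_trap * ennreal (1 - (1 - 1 / tau) ^ w)"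

definition only_trap :: "bool list list \<Rightarrow> ennreal" where
  "only_trap xs = expect (offspring xs) (\<lambda>ys. of_bool (trap \<in> set ys \<and> opt \<notin> set ys))"

definition both :: "bool list list \<Rightarrow> ennreal" where
  "both xs = expect (offspring xs) (\<lambda>ys. of_bool (trap \<in> set ys \<and> opt \<in> set ys))"

definition trap_avoid :: "nat \<Rightarrow> bool list list \<Rightarrow> ennreal" where
  "trap_avoid w xs = expect (offspring xs) (\<lambda>ys. of_bool (trap \<in> set ys \<and> opt \<notin> set ys) *
     avoid w (map2 (select fork) xs ys))"

definition trap_hit :: "nat \<Rightarrow> bool list list \<Rightarrow> ennreal" where
  "trap_hit w xs = expect (offspring xs) (\<lambda>ys. of_bool (trap \<in> set ys \<and> opt \<notin> set ys) *
     (\<Sum>j<lam. hit w (map2 (select fork) xs ys ! j)))"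

lemma remaining_clean:
  assumes xs: "clean xs"
  shows "kill xs remaining + theta w * trap_avoid w xs + 1 \<le> remaining xs"
proof -
  let ?z = "\<lambda>ys. map2 (select fork) xs ys"
  let ?u = "\<lambda>ys. of_bool (trap \<notin> set ys \<and> opt \<notin> set ys) :: ennreal"
  let ?t = "\<lambda>ys. of_bool (trap \<in> set ys \<and> opt \<notin> set ys) :: ennreal"
  have pt: "?u ys * expect (migration lam ones fl (map2 (select ones) xs ys)) remaining +
      theta w * (?t ys * avoid w (?z ys)) \<le> expect (migration lam fork fl (?z ys)) remaining"
    if "ys \<in> set_pmf (offspring xs)" for ys fl
  proof -
    have gy: "good ys" using offspring_good[OF clean_good[OF xs] that] .
    consider "trap \<notin> set ys" "opt \<notin> set ys" | "trap \<in> set ys" "opt \<notin> set ys" | "opt \<in> set ys" by blast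
    then show ?thesis
    proof cases
      case 1
      then have cy: "clean ys" using gy by (simp add: clean_def)
      have "migration lam fork fl (?z ys) = migration lam ones fl (?z ys)"
        using select_clean(2)[OF xs cy, of fork] by (intro migration_cong fork_other) (metis clean_def)+
      then have "migration lam fork fl (?z ys) = migration lam ones fl (map2 (select ones) xs ys)"
        by (simp only: select_clean(1)[OF xs cy])
      then show ?thesis using 1 by simp
    next
      case 2
      have gz: "good (?z ys)" using select_good[OF clean_good[OF xs] gy] .
      have z: "trap \<in> set (?z ys)" "opt \<notin> set (?z ys)"
        using select_trap[OF clean_good[OF xs] _ gy _ 2(2)] 2(1) xs by (auto simp: clean_def)
      have "theta w * avoid w (?z ys) \<le> expect (migration lam fork fl (?z ys)) remaining"
      proof (cases fl)
        case True
        have "ennreal (1 - (1 - 1 / tau) ^ w) * avoid w (?z ys) \<le> 1 * 1"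
          using tau_pos by (intro mult_mono avoid_le_1) auto
        then have "theta w * avoid w (?z ys) \<le> remaining all_trap * 1"
          unfolding theta_def mult.assoc by (intro mult_left_mono) auto
        then show ?thesis using True migration_trap[OF gz z] by simp
      next
        case False
        then show ?thesis using remaining_ge_avoid[OF gz z(1), of w] by (simp add: migration_def theta_def)
      qed
      then show ?thesis using 2 by simp
    qed simp
  qed
  have "kill xs remaining + theta w * trap_avoid w xs =
      expect flag (\<lambda>fl. expect (offspring xs) (\<lambda>ys.
        ?u ys * expect (migration lam ones fl (map2 (select ones) xs ys)) remaining +
        theta w * (?t ys * avoid w (?z ys))))"
    by (simp add: kill_def trap_avoid_def nn_integral_add nn_integral_cmult
        del: nn_integral_bernoulli_pmf)
  also have "\<dots> \<le> expect (fork_round xs) remaining"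
    unfolding expect_round by (intro expect_mono pt)
  finally show ?thesis
    using remaining_unfold[of xs] xs by (auto simp: has_opt_iff clean_def intro!: add_mono)
qed

lemma fork_ET_ge:
  "(\<Sum>s<T. mu s (\<lambda>_. 1) + theta w * mu s (trap_avoid w)) \<le> fork_ET n r lam tau"
proof -
  have "(\<Sum>s<T. mu s (\<lambda>_. 1) + theta w * mu s (trap_avoid w)) + mu T remaining \<le> mu 0 remaining"
  proof (induction T)
    case (Suc T)
    have "(\<Sum>s<Suc T. mu s (\<lambda>_. 1) + theta w * mu s (trap_avoid w)) + mu (Suc T) remaining =
        (\<Sum>s<T. mu s (\<lambda>_. 1) + theta w * mu s (trap_avoid w)) +
        mu T (\<lambda>xs. kill xs remaining + theta w * trap_avoid w xs + 1)"
      by (simp only: sum.lessThan_Suc mu.simps mu_add mu_cmult add_ac)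
    also have "\<dots> \<le> (\<Sum>s<T. mu s (\<lambda>_. 1) + theta w * mu s (trap_avoid w)) + mu T remaining"
      by (intro add_left_mono mu_mono remaining_clean)
    finally show ?case using Suc.IH by (rule order.trans)
  qed simp
  then have "(\<Sum>s<T. mu s (\<lambda>_. 1) + theta w * mu s (trap_avoid w)) \<le> mu 0 remaining"
    by (rule order.trans[rotated]) simp
  also have "\<dots> \<le> fork_ET n r lam tau"
    unfolding fork_ET_eq by (auto intro!: nn_integral_mono simp: of_bool_def)
  finally show ?thesis .
qed

lemma kill_one: "kill xs (\<lambda>_. 1) = expect (offspring xs) (\<lambda>ys. of_bool (trap \<notin> set ys \<and> opt \<notin> set ys))"
  by (simp add: kill_def del: nn_integral_bernoulli_pmf)

lemma kill_one_add:
  "kill xs (\<lambda>_. 1) + expect (offspring xs) (\<lambda>ys. of_bool (trap \<in> set ys \<or> opt \<in> set ys)) = 1"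
  unfolding kill_one using expect_of_bool_add_not[of "offspring xs" "\<lambda>ys. trap \<notin> set ys \<and> opt \<notin> set ys"]
  by simp

lemma mu_one_split: "mu s (\<lambda>_. 1) = mu (Suc s) (\<lambda>_. 1) + (2 * mu s only_trap + mu s both)"
proof -
  let ?o = "\<lambda>xs. expect (offspring xs) (\<lambda>ys. of_bool (opt \<in> set ys \<and> trap \<notin> set ys)) :: ennreal"
  have "expect (offspring xs) (\<lambda>ys. of_bool (trap \<in> set ys \<or> opt \<in> set ys)) =
      only_trap xs + (?o xs + both xs)" for xs
  proof -
    have "only_trap xs + (?o xs + both xs) = expect (offspring xs) (\<lambda>ys.
        of_bool (trap \<in> set ys \<and> opt \<notin> set ys) + (of_bool (opt \<in> set ys \<and> trap \<notin> set ys) +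
        of_bool (trap \<in> set ys \<and> opt \<in> set ys)))"
      by (simp add: only_trap_def both_def nn_integral_add)
    also have "\<dots> = expect (offspring xs) (\<lambda>ys. of_bool (trap \<in> set ys \<or> opt \<in> set ys))"
      by (intro nn_integral_cong) auto
    finally show ?thesis by simp
  qed
  then have "mu s (\<lambda>_. 1) = mu s (\<lambda>xs. kill xs (\<lambda>_. 1) + (only_trap xs + (?o xs + both xs)))"
    using kill_one_add by simp
  also have "\<dots> = mu (Suc s) (\<lambda>_. 1) + (mu s only_trap + (mu s ?o + mu s both))"
    by (simp add: mu_add)
  also have "mu s ?o = mu s only_trap"
    using mu_offspring_swap[of s] by (simp add: only_trap_def[abs_def])
  finally show ?thesis by (simp add: mult_2 add.assoc)
qed

lemma mu_one_telescope:
  "mu 0 (\<lambda>_. 1) = mu T (\<lambda>_. 1) + (\<Sum>s<T. 2 * mu s only_trap + mu s both)"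
proof (induction T)
  case (Suc T)
  then show ?case by (simp only: mu_one_split[of T] sum.lessThan_Suc) (simp add: algebra_simps)
qed simp

abbreviation "pair_bound \<equiv> ennreal (real (2 * r) ^ (2 * r) / real n ^ (2 * r))"
abbreviation "single_bound \<equiv> ennreal (real r ^ r / real n ^ r)"

lemma mu_both: "mu s both \<le> of_nat (lam * lam) * pair_bound"
proof -
  have "mu s both \<le> mu s (\<lambda>xs. \<Sum>i<lam. \<Sum>j<lam.
      ennreal (pmf (mutate n (xs ! i)) trap) * ennreal (pmf (ea_offspring 0 (xs ! j)) opt))"
  proof (rule mu_mono)
    fix xs assume xs: "clean xs"
    have len: "length xs = lam" using xs by (simp add: clean_def good_def)
    have "both xs \<le> expect (offspring xs) (\<lambda>ys. (\<Sum>i<lam. of_bool (ys ! i = trap)) * (\<Sum>j<lam. of_bool (ys ! j = opt)))"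
      unfolding both_def
    proof (rule expect_mono)
      fix ys assume "ys \<in> set_pmf (offspring xs)"
      then have "length ys = lam" using length_seq_pmf len by fastforce
      then have "of_bool (trap \<in> set ys) * of_bool (opt \<in> set ys) \<le>
          (\<Sum>i<lam. of_bool (ys ! i = trap)) * (\<Sum>j<lam. of_bool (ys ! j = opt) :: ennreal)"
        by (intro mult_mono of_bool_mem_le_sum) auto
      then show "of_bool (trap \<in> set ys \<and> opt \<in> set ys) \<le>
          (\<Sum>i<lam. of_bool (ys ! i = trap)) * (\<Sum>j<lam. of_bool (ys ! j = opt) :: ennreal)"
        by (simp only: of_bool_conj)
    qed
    also have "\<dots> = (\<Sum>i<lam. \<Sum>j<lam. expect (offspring xs) (\<lambda>ys. of_bool (ys ! i = trap) * of_bool (ys ! j = opt)))"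
      by (simp only: sum_product expect_sum)
    also have "\<dots> \<le> (\<Sum>i<lam. \<Sum>j<lam.
        ennreal (pmf (mutate n (xs ! i)) trap) * ennreal (pmf (ea_offspring 0 (xs ! j)) opt))"
    proof (intro sum_mono)
      fix i j assume ij: "i \<in> {..<lam}" "j \<in> {..<lam}"
      show "expect (offspring xs) (\<lambda>ys. of_bool (ys ! i = trap) * of_bool (ys ! j = opt)) \<le>
          ennreal (pmf (mutate n (xs ! i)) trap) * ennreal (pmf (ea_offspring 0 (xs ! j)) opt)"
      proof (cases "i = j")
        case True
        then have "(\<lambda>ys. of_bool (ys ! i = trap) * of_bool (ys ! j = opt) :: ennreal) = (\<lambda>_. 0)" by auto
        then show ?thesis by simp
      next
        case False
        then show ?thesis using ij len
          by (simp add: expect_nth_pair_seq_pmf[where f = "\<lambda>y. of_bool (y = trap)" and g = "\<lambda>y. of_bool (y = opt)"]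
              expect_of_bool_eq)
      qed
    qed
    finally show "both xs \<le> \<dots>" .
  qed
  also have "\<dots> = (\<Sum>i<lam. \<Sum>j<lam. mu s (\<lambda>xs.
      ennreal (pmf (mutate n (xs ! i)) trap) * ennreal (pmf (ea_offspring 0 (xs ! j)) opt)))"
    by (simp add: mu_sum del: ea_offspring.simps)
  also have "\<dots> \<le> (\<Sum>i<lam. \<Sum>j<lam. pair_bound)"
    by (intro sum_mono order.trans[OF mu_le_nu expect_nu_pair]) auto
  finally show ?thesis by (simp add: mult.assoc)
qed

lemma mu_only_trap: "mu s only_trap \<le> mu s (trap_avoid w) + mu s (trap_hit w)"
  unfolding mu_add[symmetric]
proof (rule mu_mono)
  fix xs assume xs: "clean xs"
  have "only_trap xs \<le> expect (offspring xs) (\<lambda>ys. of_bool (trap \<in> set ys \<and> opt \<notin> set ys) *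
     (avoid w (map2 (select fork) xs ys) + (\<Sum>j<lam. hit w (map2 (select fork) xs ys ! j))))"
    unfolding only_trap_def
  proof (rule expect_mono)
    fix ys assume "ys \<in> set_pmf (offspring xs)"
    then have "good (map2 (select fork) xs ys)"
      using select_good offspring_good clean_good[OF xs] by blast
    from mult_left_mono[OF avoid_hit[OF this, of w], of "of_bool (trap \<in> set ys \<and> opt \<notin> set ys)"]
    show "of_bool (trap \<in> set ys \<and> opt \<notin> set ys) \<le> of_bool (trap \<in> set ys \<and> opt \<notin> set ys) *
      (avoid w (map2 (select fork) xs ys) + (\<Sum>j<lam. hit w (map2 (select fork) xs ys ! j)))" by simp
  qed
  then show "only_trap xs \<le> trap_avoid w xs + trap_hit w xs"
    by (simp add: trap_avoid_def trap_hit_def distrib_left nn_integral_add)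
qed

lemma mu_trap_hit:
  "mu s (trap_hit w) \<le> of_nat (lam * lam) *
     (of_nat w * pair_bound + single_bound * ennreal (real w / real n ^ (2 * r)))"
proof -
  let ?e = "ennreal (real w / real n ^ (2 * r))"
  let ?B = "\<lambda>i j xs. (\<Sum>k<w. ennreal (pmf (mutate n (xs ! i)) trap) * ennreal (pmf (ea_offspring (Suc k) (xs ! j)) opt))
      + ?e * ennreal (pmf (mutate n (xs ! i)) trap)"
  have "mu s (trap_hit w) \<le> mu s (\<lambda>xs. \<Sum>i<lam. \<Sum>j<lam. ?B i j xs)"
  proof (rule mu_mono)
    fix xs assume xs: "clean xs"
    have len: "length xs = lam" using xs by (simp add: clean_def good_def)
    let ?h = "\<lambda>j y. of_bool (y \<noteq> opt) * hit w (select fork (xs ! j) y)"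
    have "trap_hit w xs \<le> expect (offspring xs) (\<lambda>ys.
        (\<Sum>i<lam. of_bool (ys ! i = trap)) * (\<Sum>j<lam. ?h j (ys ! j)))"
      unfolding trap_hit_def
    proof (rule expect_mono)
      fix ys assume "ys \<in> set_pmf (offspring xs)"
      then have gy: "good ys" using offspring_good clean_good[OF xs] by blast
      show "of_bool (trap \<in> set ys \<and> opt \<notin> set ys) * (\<Sum>j<lam. hit w (map2 (select fork) xs ys ! j))
          \<le> (\<Sum>i<lam. of_bool (ys ! i = trap)) * (\<Sum>j<lam. ?h j (ys ! j))"
      proof (cases "opt \<in> set ys")
        case False
        then have no: "ys ! j \<noteq> opt" if "j < lam" for j using that good_length[OF gy] by (metis nth_mem)
        have "(\<Sum>j<lam. hit w (map2 (select fork) xs ys ! j)) = (\<Sum>j<lam. ?h j (ys ! j))"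
          using no nth_select[OF clean_good[OF xs] gy] by (intro sum.cong refl) (simp del: nth_map nth_zip)
        moreover have "of_bool (trap \<in> set ys \<and> opt \<notin> set ys) \<le> (\<Sum>i<lam. of_bool (ys ! i = trap) :: ennreal)"
          using of_bool_mem_le_sum[OF good_length[OF gy], of trap] False by simp
        ultimately show ?thesis by (simp only: mult_right_mono zero_le)
      qed simp
    qed
    also have "\<dots> = (\<Sum>i<lam. \<Sum>j<lam. expect (offspring xs) (\<lambda>ys. of_bool (ys ! i = trap) * ?h j (ys ! j)))"
      by (simp only: sum_product expect_sum)
    also have "\<dots> \<le> (\<Sum>i<lam. \<Sum>j<lam. ?B i j xs)"
    proof (intro sum_mono)
      fix i j assume ij: "i \<in> {..<lam}" "j \<in> {..<lam}"
      show "expect (offspring xs) (\<lambda>ys. of_bool (ys ! i = trap) * ?h j (ys ! j)) \<le> ?B i j xs"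
      proof (cases "i = j")
        case True
        have "expect (offspring xs) (\<lambda>ys. of_bool (ys ! i = trap) * ?h j (ys ! j)) \<le>
            expect (offspring xs) (\<lambda>ys. ?e * of_bool (ys ! i = trap))"
          using True clean_nth[OF xs, of i] ij hit_trap[of w]
          by (intro expect_mono) (auto simp: select_fork_trap)
        also have "\<dots> = ?e * ennreal (pmf (mutate n (xs ! i)) trap)"
          using ij len by (simp add: nn_integral_cmult expect_nth_seq_pmf[where f = "\<lambda>y. of_bool (y = trap)"]
              expect_of_bool_eq)
        finally show ?thesis by (rule order.trans) simp
      next
        case False
        have xj: "length (xs ! j) = n" "xs ! j \<noteq> trap" "xs ! j \<noteq> opt" using clean_nth[OF xs, of j] ij by auto
        have "expect (mutate n (xs ! j)) (?h j) \<le> expect (mutate n (xs ! j)) (\<lambda>y.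
            (\<Sum>k<w. ennreal (pmf (ea_offspring k (select ones (xs ! j) y)) opt)) + ?e)"
        proof (rule expect_mono)
          fix y assume "y \<in> set_pmf (mutate n (xs ! j))"
          then have "length y = n" using length_mutate xj by metis
          from hit_select_le[OF xj this, of w]
          show "?h j y \<le> (\<Sum>k<w. ennreal (pmf (ea_offspring k (select ones (xs ! j) y)) opt)) + ?e"
            by (cases "y = opt") (auto simp del: sum_ennreal)
        qed
        also have "\<dots> = (\<Sum>k<w. ennreal (pmf (ea_offspring (Suc k) (xs ! j)) opt)) + ?e"
          by (simp add: nn_integral_add nn_integral_sum ennreal_pmf_bind del: sum_ennreal)
        finally have *: "expect (mutate n (xs ! j)) (?h j) \<le> \<dots>" .
        have "expect (offspring xs) (\<lambda>ys. of_bool (ys ! i = trap) * ?h j (ys ! j)) =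
            ennreal (pmf (mutate n (xs ! i)) trap) * expect (mutate n (xs ! j)) (?h j)"
          using ij len False
          by (simp add: expect_nth_pair_seq_pmf[where f = "\<lambda>y. of_bool (y = trap)" and g = "?h j"]
              expect_of_bool_eq)
        also have "\<dots> \<le> ennreal (pmf (mutate n (xs ! i)) trap) *
            ((\<Sum>k<w. ennreal (pmf (ea_offspring (Suc k) (xs ! j)) opt)) + ?e)"
          by (intro mult_left_mono *) simp
        also have "\<dots> = ?B i j xs"
          by (simp only: distrib_left sum_distrib_left mult.commute[of _ ?e])
        finally show ?thesis .
      qed
    qed
    finally show "trap_hit w xs \<le> \<dots>" .
  qed
  also have "\<dots> = (\<Sum>i<lam. \<Sum>j<lam. (\<Sum>k<w. mu s (\<lambda>xs. ennreal (pmf (mutate n (xs ! i)) trap) *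
      ennreal (pmf (ea_offspring (Suc k) (xs ! j)) opt))) + ?e * mu s (\<lambda>xs. ennreal (pmf (mutate n (xs ! i)) trap)))"
    by (simp only: mu_sum mu_add mu_cmult finite_lessThan)
  also have "\<dots> \<le> (\<Sum>i<lam. \<Sum>j<lam. (\<Sum>k<w. pair_bound) + ?e * single_bound)"
    by (intro sum_mono add_mono mult_left_mono order.trans[OF mu_le_nu expect_nu_pair]
        order.trans[OF mu_le_nu expect_nu_special]) auto
  also have "\<dots> = of_nat (lam * lam) * (of_nat w * pair_bound + single_bound * ?e)"
    by (simp add: mult.assoc mult.commute[of ?e])
  finally show ?thesis .
qed

lemma mu_special:
  "mu s (\<lambda>xs. expect (offspring xs) (\<lambda>ys. of_bool (trap \<in> set ys \<or> opt \<in> set ys))) \<le>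
     2 * of_nat lam * single_bound"
proof -
  have "mu s (\<lambda>xs. expect (offspring xs) (\<lambda>ys. of_bool (trap \<in> set ys \<or> opt \<in> set ys))) \<le>
      mu s (\<lambda>xs. (\<Sum>i<lam. ennreal (pmf (mutate n (xs ! i)) trap)) + (\<Sum>i<lam. ennreal (pmf (mutate n (xs ! i)) opt)))"
  proof (rule mu_mono)
    fix xs assume xs: "clean xs"
    have len: "length xs = lam" using xs by (simp add: clean_def good_def)
    have "expect (offspring xs) (\<lambda>ys. of_bool (trap \<in> set ys \<or> opt \<in> set ys)) \<le>
        expect (offspring xs) (\<lambda>ys. of_bool (trap \<in> set ys) + of_bool (opt \<in> set ys))"
      by (intro nn_integral_mono) auto
    also have "\<dots> = expect (offspring xs) (\<lambda>ys. of_bool (trap \<in> set ys)) +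
        expect (offspring xs) (\<lambda>ys. of_bool (opt \<in> set ys))"
      by (rule nn_integral_add) auto
    also have "\<dots> \<le> (\<Sum>i<lam. ennreal (pmf (mutate n (xs ! i)) trap)) + (\<Sum>i<lam. ennreal (pmf (mutate n (xs ! i)) opt))"
      using expect_mem_seq_pmf_le[of "map (mutate n) xs" trap] expect_mem_seq_pmf_le[of "map (mutate n) xs" opt] len
      by (intro add_mono) (simp_all del: sum_ennreal)
    finally show "expect (offspring xs) (\<lambda>ys. of_bool (trap \<in> set ys \<or> opt \<in> set ys)) \<le> \<dots>" .
  qed
  also have "\<dots> = (\<Sum>i<lam. mu s (\<lambda>xs. ennreal (pmf (mutate n (xs ! i)) trap))) +
      (\<Sum>i<lam. mu s (\<lambda>xs. ennreal (pmf (mutate n (xs ! i)) opt)))"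
    by (simp only: mu_add mu_sum finite_lessThan)
  also have "\<dots> \<le> (\<Sum>i<lam. single_bound) + (\<Sum>i<lam. single_bound)"
    by (intro add_mono sum_mono order.trans[OF mu_le_nu expect_nu_special]) auto
  finally show ?thesis by (simp add: mult_2 distrib_right)
qed

lemma mu_zero_one: "1 \<le> mu 0 (\<lambda>_. 1) + 2 * of_nat lam * single_bound"
proof -
  have u: "pmf (uniform_bits n) y \<le> real r ^ r / real n ^ r" if "y = trap \<or> y = opt" for y
    using that act_uniform_bits uniform_bits_support by (intro pmf_invariant_special_le) auto
  have "1 = expect (island_init n lam) (\<lambda>_. 1)" by simp
  also have "\<dots> \<le> expect (island_init n lam) (\<lambda>xs. of_bool (clean xs) +
      (of_bool (trap \<in> set xs) + of_bool (opt \<in> set xs)))"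
    by (intro expect_mono) (auto dest: init_good simp: clean_def)
  also have "\<dots> = mu 0 (\<lambda>_. 1) + (expect (island_init n lam) (\<lambda>xs. of_bool (trap \<in> set xs)) +
      expect (island_init n lam) (\<lambda>xs. of_bool (opt \<in> set xs)))"
    by (simp add: nn_integral_add)
  also have "\<dots> \<le> mu 0 (\<lambda>_. 1) + ((\<Sum>i<lam. single_bound) + (\<Sum>i<lam. single_bound))"
  proof -
    have "expect (island_init n lam) (\<lambda>xs. of_bool (y \<in> set xs)) \<le> (\<Sum>i<lam. single_bound)"
      if "y = trap \<or> y = opt" for y
    proof -
      have "expect (island_init n lam) (\<lambda>xs. of_bool (y \<in> set xs)) \<le>
          (\<Sum>i<lam. ennreal (pmf (uniform_bits n) y))"
        using expect_mem_seq_pmf_le[of "replicate lam (uniform_bits n)" y] by (simp add: island_init_def)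
      also have "\<dots> \<le> (\<Sum>i<lam. single_bound)"
        by (intro sum_mono ennreal_leI u that)
      finally show ?thesis .
    qed
    then show ?thesis by (intro add_mono) auto
  qed
  finally show ?thesis by (simp add: mult_2 distrib_right)
qed

lemma mu_one_ge: "1 \<le> mu s (\<lambda>_. 1) + of_nat (Suc s) * (2 * of_nat lam * single_bound)"
proof (induction s)
  case 0
  then show ?case using mu_zero_one by simp
next
  case (Suc s)
  have "mu s (\<lambda>_. 1) = mu s (\<lambda>xs. kill xs (\<lambda>_. 1) + expect (offspring xs) (\<lambda>ys. of_bool (trap \<in> set ys \<or> opt \<in> set ys)))"
    using kill_one_add by simp
  also have "\<dots> \<le> mu (Suc s) (\<lambda>_. 1) + 2 * of_nat lam * single_bound"
    using mu_special by (simp add: mu_add add_left_mono)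
  finally have "mu s (\<lambda>_. 1) + of_nat (Suc s) * (2 * of_nat lam * single_bound) \<le>
      (mu (Suc s) (\<lambda>_. 1) + 2 * of_nat lam * single_bound) + of_nat (Suc s) * (2 * of_nat lam * single_bound)"
    by (rule add_right_mono)
  from order.trans[OF Suc.IH this] show ?case
    by (simp only: of_nat_Suc[of "Suc s"] distrib_right mult_1_left add.assoc)
qed

subsection \<open>Climbing to the all-ones string\<close>

abbreviation "all_one \<equiv> replicate n True"

lemma expect_zeros_mutate:
  assumes x: "length x = n"
  shows "expect (mutate n x) (\<lambda>y. of_nat (n - ones (select ones x y))) \<le>
    ennreal (1 - 1 / (3 * real n)) * of_nat (n - ones x)"
proof -
  define D where "D = {i. i < n \<and> \<not> x ! i}"
  define U where "U = (\<lambda>i. x[i := True]) ` D"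
  have D: "finite D" "card D = n - ones x" using zeros_eq_card[of x] x by (auto simp: D_def)
  have n0: "real n > 0" using n_ge_2 by simp
  have inj: "inj_on (\<lambda>i. x[i := True]) D"
  proof (rule inj_onI)
    fix i j assume "i \<in> D" "j \<in> D" "x[i := True] = x[j := True]"
    then show "i = j" using x by (metis (no_types, lifting) D_def mem_Collect_eq nth_list_update_eq nth_list_update_neq)
  qed
  have pmf_U: "1 / (3 * real n) \<le> pmf (mutate n x) y" if y: "y \<in> U" for y
  proof -
    obtain i where i: "i < n" "\<not> x ! i" "y = x[i := True]" using y by (auto simp: U_def D_def)
    have "{j. j < n \<and> x ! j \<noteq> y ! j} = {i}" "{j. j < n \<and> x ! j = y ! j} = {..<n} - {i}"
      using i x by (auto simp: nth_list_update)
    then have "pmf (mutate n x) y = (1 / n) ^ 1 * (1 - 1 / n) ^ (n - 1)"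
      using pmf_mutate[of n y x] n_ge_2 x i by simp
    moreover have "(1 / n) * (1 / 3) \<le> (1 / n) * (1 - 1 / n) ^ (n - 1)"
      using one_minus_inverse_power_ge[OF n_ge_2] by (intro mult_left_mono) auto
    ultimately show ?thesis by simp
  qed
  have "real (n - ones x) * (1 / (3 * real n)) = (\<Sum>y\<in>U. 1 / (3 * real n))"
    using D card_image[OF inj] by (simp add: U_def)
  also have "\<dots> \<le> (\<Sum>y\<in>U. pmf (mutate n x) y)" by (intro sum_mono pmf_U)
  also have "\<dots> = measure (measure_pmf (mutate n x)) U"
    using D by (simp add: U_def measure_measure_pmf_finite)
  finally have "ennreal (real (n - ones x) * (1 / (3 * real n))) \<le> emeasure (measure_pmf (mutate n x)) U"
    by (simp add: measure_pmf.emeasure_eq_measure ennreal_leI)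
  also have "\<dots> = expect (mutate n x) (\<lambda>y. of_bool (y \<in> U))"
  proof -
    have "expect (mutate n x) (\<lambda>y. of_bool (y \<in> U)) = expect (mutate n x) (indicator U)"
      by (intro nn_integral_cong) (auto simp: indicator_def)
    then show ?thesis by simp
  qed
  finally have "expect (mutate n x) (\<lambda>y. of_nat (n - ones (select ones x y))) +
      ennreal (real (n - ones x) * (1 / (3 * real n))) \<le>
      expect (mutate n x) (\<lambda>y. of_nat (n - ones (select ones x y))) + expect (mutate n x) (\<lambda>y. of_bool (y \<in> U))"
    by (intro add_left_mono)
  also have "\<dots> = expect (mutate n x) (\<lambda>y. of_nat (n - ones (select ones x y)) + of_bool (y \<in> U))"
    by (rule nn_integral_add[symmetric]) auto
  also have "\<dots> \<le> expect (mutate n x) (\<lambda>y. of_nat (n - ones x))"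
  proof (rule expect_mono)
    fix y
    show "of_nat (n - ones (select ones x y)) + of_bool (y \<in> U) \<le> (of_nat (n - ones x) :: ennreal)"
    proof (cases "y \<in> U")
      case True
      then obtain i where i: "i < n" "\<not> x ! i" "y = x[i := True]" by (auto simp: U_def D_def)
      then have o: "ones y = Suc (ones x)" using ones_list_update x by simp
      moreover have "length y = n" using i x by simp
      ultimately have "n - ones (select ones x y) + 1 \<le> n - ones x"
        using ones_le_length[of y] by (simp add: select_def)
      then have "of_nat (n - ones (select ones x y) + 1) \<le> (of_nat (n - ones x) :: ennreal)"
        by (simp only: of_nat_le_iff)
      then show ?thesis using True by (simp only: of_nat_add of_nat_1 of_bool_eq)
    qed (auto simp: select_def intro!: of_nat_mono diff_le_mono2)
  qed
  finally have "expect (mutate n x) (\<lambda>y. of_nat (n - ones (select ones x y))) \<le>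
      ennreal (real (n - ones x) - real (n - ones x) * (1 / (3 * real n)))"
    by (intro ennreal_le_of_add_le) (auto simp: ennreal_of_nat_eq_real_of_nat)
  also have "\<dots> = ennreal ((1 - 1 / (3 * real n)) * real (n - ones x))" by (simp add: algebra_simps)
  also have "\<dots> = ennreal (1 - 1 / (3 * real n)) * of_nat (n - ones x)"
    using n0 n_ge_2 by (subst ennreal_mult) (auto simp: ennreal_of_nat_eq_real_of_nat field_simps)
  finally show ?thesis .
qed

definition zeros :: "bool list list \<Rightarrow> ennreal" where
  "zeros xs = (\<Sum>i<lam. of_nat (n - ones (xs ! i)))"

lemma kill_zeros:
  assumes xs: "clean xs"
  shows "kill xs zeros \<le> ennreal (1 - 1 / (3 * real n)) * zeros xs"
proof -
  have gx: "good xs" using clean_good[OF xs] .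
  have "kill xs zeros \<le> expect flag (\<lambda>_. expect (offspring xs)
      (\<lambda>ys. \<Sum>i<lam. of_nat (n - ones (select ones (xs ! i) (ys ! i)))))"
    unfolding kill_def
  proof (intro expect_mono)
    fix fl ys assume "ys \<in> set_pmf (offspring xs)"
    then have gy: "good ys" using offspring_good[OF gx] by blast
    let ?z = "map2 (select ones) xs ys"
    have gz: "good ?z" using select_good[OF gx gy] .
    have "expect (migration lam ones fl ?z) zeros \<le> expect (migration lam ones fl ?z) (\<lambda>_. zeros ?z)"
      unfolding zeros_def using migration_support(3)[OF good_length[OF gz]]
      by (intro expect_mono sum_mono of_nat_mono diff_le_mono2) auto
    also have "\<dots> = (\<Sum>i<lam. of_nat (n - ones (select ones (xs ! i) (ys ! i))))"
      unfolding expect_const zeros_def using nth_select[OF gx gy, of _ ones]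
      by (intro sum.cong refl) (simp del: nth_map nth_zip)
    finally have *: "expect (migration lam ones fl ?z) zeros \<le> \<dots>" .
    show "of_bool (trap \<notin> set ys \<and> opt \<notin> set ys) * expect (migration lam ones fl ?z) zeros \<le>
        (\<Sum>i<lam. of_nat (n - ones (select ones (xs ! i) (ys ! i))))"
      by (rule order.trans[OF _ *]) (simp add: of_bool_def)
  qed
  also have "\<dots> = (\<Sum>i<lam. expect (offspring xs) (\<lambda>ys. of_nat (n - ones (select ones (xs ! i) (ys ! i)))))"
    by (simp only: expect_const expect_sum)
  also have "\<dots> = (\<Sum>i<lam. expect (mutate n (xs ! i)) (\<lambda>y. of_nat (n - ones (select ones (xs ! i) y))))"
    using good_length[OF gx]
    by (intro sum.cong refl) (simp add: expect_nth_seq_pmf[where f = "\<lambda>y. of_nat (n - ones (select ones _ y))"])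
  also have "\<dots> \<le> (\<Sum>i<lam. ennreal (1 - 1 / (3 * real n)) * of_nat (n - ones (xs ! i)))"
    using good_nth[OF gx] by (intro sum_mono expect_zeros_mutate) auto
  finally show ?thesis by (simp add: zeros_def sum_distrib_left)
qed

lemma mu_zeros: "mu s zeros \<le> ennreal (real lam * real n * (1 - 1 / (3 * real n)) ^ s)"
proof (induction s)
  case 0
  have "zeros xs \<le> (\<Sum>i<lam. of_nat n)" for xs
    unfolding zeros_def by (intro sum_mono of_nat_mono) simp
  then have "mu 0 zeros \<le> expect (nu 0) (\<lambda>_. \<Sum>i<lam. of_nat n)"
    by (intro order.trans[OF mu_le_nu] expect_mono)
  then show ?case by (simp add: ennreal_mult ennreal_of_nat_eq_real_of_nat)
next
  case (Suc s)
  have n3: "0 \<le> 1 - 1 / (3 * real n)" using n_ge_2 by (simp add: field_simps)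
  have "mu (Suc s) zeros \<le> ennreal (1 - 1 / (3 * real n)) * mu s zeros"
    unfolding mu_cmult[symmetric] mu.simps by (intro mu_mono kill_zeros)
  also have "\<dots> \<le> ennreal (1 - 1 / (3 * real n)) * ennreal (real lam * real n * (1 - 1 / (3 * real n)) ^ s)"
    by (intro mult_left_mono Suc.IH) auto
  also have "\<dots> = ennreal (real lam * real n * (1 - 1 / (3 * real n)) ^ Suc s)"
    using n3 by (subst ennreal_mult[symmetric]) (auto simp: algebra_simps)
  finally show ?case .
qed

lemma pmf_mutate_all_one: "1 / (3 * real n ^ r) \<le> pmf (mutate n all_one) trap"
proof -
  have "{i. i < n \<and> all_one ! i \<noteq> trap ! i} = {..<r}" "{i. i < n \<and> all_one ! i = trap ! i} = {r..<n}"
    using two_r_le_n by (auto simp: nth_trap)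
  then have "pmf (mutate n all_one) trap = (1 / n) ^ r * (1 - 1 / n) ^ (n - r)"
    using pmf_mutate[of n trap all_one] n_ge_2 by simp
  moreover have "1 / 3 \<le> (1 - 1 / real n) ^ (n - r)"
    using n_ge_2 r_pos
    by (intro order.trans[OF one_minus_inverse_power_ge[OF n_ge_2]] power_decreasing) auto
  then have "(1 / n) ^ r * (1 / 3) \<le> (1 / n) ^ r * (1 - 1 / n) ^ (n - r)"
    by (intro mult_left_mono) auto
  ultimately show ?thesis by (simp add: power_divide)
qed

lemma kill_one_le:
  assumes xs: "clean xs" and lam: "real lam \<le> real n ^ r"
  shows "kill xs (\<lambda>_. 1) \<le> ennreal (1 - lam / (6 * real n ^ r)) + ennreal (lam / (6 * real n ^ r)) * zeros xs"
proof -
  define \<rho> where "\<rho> = lam / (6 * real n ^ r)"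
  have N: "real n ^ r > 0" using n_ge_2 by simp
  have \<rho>: "0 \<le> \<rho>" "\<rho> \<le> 1 / 6" using lam N by (auto simp: \<rho>_def field_simps)
  show ?thesis
  proof (cases "\<forall>i<lam. xs ! i = all_one")
    case True
    have xs1: "xs = replicate lam all_one"
      using True good_length[OF clean_good[OF xs]] by (intro nth_equalityI) auto
    define x where "x = lam / (3 * real n ^ r)"
    have "real lam \<le> 3 * real n ^ r" using lam N by linarith
    then have x: "0 \<le> x" "x \<le> 1" using N by (auto simp: x_def divide_le_eq)
    have "1 \<le> real n ^ r" using n_ge_2 by (intro one_le_power) auto
    then have p1: "1 / (3 * real n ^ r) \<le> 1" using N by (simp add: divide_le_eq)
    have "expect (mutate n all_one) (\<lambda>y. of_bool (y \<noteq> trap)) + ennreal (1 / (3 * real n ^ r)) \<le>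
        expect (mutate n all_one) (\<lambda>y. of_bool (y \<noteq> trap)) + expect (mutate n all_one) (\<lambda>y. of_bool (y = trap))"
      unfolding expect_of_bool_eq by (intro add_left_mono ennreal_leI pmf_mutate_all_one)
    also have "\<dots> = ennreal 1"
      using expect_of_bool_add_not[of "mutate n all_one" "\<lambda>y. y = trap"] by (simp add: add.commute)
    finally have one: "expect (mutate n all_one) (\<lambda>y. of_bool (y \<noteq> trap)) \<le> ennreal (1 - 1 / (3 * real n ^ r))"
      by (intro ennreal_le_of_add_le) auto
    have "kill xs (\<lambda>_. 1) \<le> expect (offspring xs) (\<lambda>ys. of_bool (\<forall>y\<in>set ys. y \<noteq> trap))"
      unfolding kill_one by (intro nn_integral_mono) auto
    also have "\<dots> = expect (mutate n all_one) (\<lambda>y. of_bool (y \<noteq> trap)) ^ lam"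
      unfolding expect_all_seq_pmf xs1 by (simp add: prod_list_replicate)
    also have "\<dots> \<le> ennreal (1 - 1 / (3 * real n ^ r)) ^ lam" by (intro power_mono one) auto
    also have "\<dots> = ennreal ((1 - 1 / (3 * real n ^ r)) ^ lam)"
      using p1 by (intro ennreal_power) simp
    also have "\<dots> \<le> ennreal (1 - \<rho>)"
    proof (rule ennreal_leI)
      have "(1 - 1 / (3 * real n ^ r)) ^ lam \<le> exp (- (1 / (3 * real n ^ r))) ^ lam"
        using p1 exp_ge_add_one_self[of "- (1 / (3 * real n ^ r))"] by (intro power_mono) auto
      also have "\<dots> = exp (- x)" by (simp add: x_def flip: exp_of_nat_mult)
      also have "\<dots> = 1 / exp x" by (simp add: exp_minus field_simps)
      also have "\<dots> \<le> 1 / (1 + x)" using x exp_ge_add_one_self[of x] by (intro divide_left_mono) auto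
      also have "\<dots> \<le> 1 - x / 2"
      proof -
        have "x * x \<le> x * 1" using x by (intro mult_left_mono) auto
        then have "1 \<le> (1 - x / 2) * (1 + x)" by (simp add: algebra_simps)
        then show ?thesis using x by (simp add: divide_le_eq)
      qed
      also have "\<dots> = 1 - \<rho>" by (simp add: x_def \<rho>_def)
      finally show "(1 - 1 / (3 * real n ^ r)) ^ lam \<le> 1 - \<rho>" .
    qed
    finally show ?thesis unfolding \<rho>_def by (rule order.trans) simp
  next
    case False
    then obtain i where i: "i < lam" "xs ! i \<noteq> all_one" by blast
    have len: "length (xs ! i) = n" using clean_nth[OF xs i(1)] by simp
    have "{j. j < n \<and> \<not> xs ! i ! j} \<noteq> {}"
      using i(2) len by (auto simp: list_eq_iff_nth_eq)
    then have "1 \<le> n - ones (xs ! i)"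
      using zeros_eq_card[of "xs ! i"] len by (simp add: Suc_le_eq card_gt_0_iff)
    then have "1 \<le> (of_nat (n - ones (xs ! i)) :: ennreal)"
      using of_nat_mono[of 1 "n - ones (xs ! i)", where ?'a = ennreal] by simp
    also have "\<dots> \<le> zeros xs"
      unfolding zeros_def using i(1) by (intro member_le_sum) auto
    finally have z: "1 \<le> zeros xs" .
    have "kill xs (\<lambda>_. 1) \<le> 1" using kill_one_add[of xs] by (metis le_iff_add)
    also have "1 = ennreal (1 - \<rho>) + ennreal \<rho> * 1"
      using \<rho> by (simp flip: ennreal_plus)
    also have "\<dots> \<le> ennreal (1 - \<rho>) + ennreal \<rho> * zeros xs"
      by (intro add_left_mono mult_left_mono z) auto
    finally show ?thesis unfolding \<rho>_def .
  qed
qed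

lemma mu_one_le:
  assumes lam: "real lam \<le> real n ^ r"
  shows "mu (t + k) (\<lambda>_. 1) \<le> ennreal ((1 - lam / (6 * real n ^ r)) ^ k + real lam * real n * (1 - 1 / (3 * real n)) ^ t)"
proof -
  define \<rho> where "\<rho> = lam / (6 * real n ^ r)"
  define \<eta> where "\<eta> = real lam * real n * (1 - 1 / (3 * real n)) ^ t"
  have N: "real n ^ r > 0" using n_ge_2 by simp
  have \<rho>: "0 \<le> \<rho>" "\<rho> \<le> 1 / 6" using lam N by (auto simp: \<rho>_def field_simps)
  have n3: "0 \<le> 1 - 1 / (3 * real n)" "1 - 1 / (3 * real n) \<le> 1" using n_ge_2 by (auto simp: field_simps)
  have \<eta>: "0 \<le> \<eta>" using n3 by (simp add: \<eta>_def)
  have "mu (t + k) (\<lambda>_. 1) \<le> ennreal ((1 - \<rho>) ^ k + \<eta>)"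
  proof (induction k)
    case 0
    have "mu t (\<lambda>_. 1) \<le> 1" using mu_le_nu[of t "\<lambda>_. 1"] by simp
    also have "1 \<le> ennreal (1 + \<eta>)" using \<eta> by simp
    finally show ?case by simp
  next
    case (Suc k)
    have "mu (t + k) zeros \<le> ennreal (real lam * real n * (1 - 1 / (3 * real n)) ^ (t + k))" by (rule mu_zeros)
    also have "\<dots> \<le> ennreal \<eta>"
      unfolding \<eta>_def using n3 by (intro ennreal_leI mult_left_mono power_decreasing) auto
    finally have z: "mu (t + k) zeros \<le> ennreal \<eta>" .
    have "mu (t + Suc k) (\<lambda>_. 1) \<le> mu (t + k) (\<lambda>xs. ennreal (1 - \<rho>) * 1 + ennreal \<rho> * zeros xs)"
      using kill_one_le[OF _ lam] by (auto simp: \<rho>_def intro!: mu_mono)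
    also have "\<dots> = ennreal (1 - \<rho>) * mu (t + k) (\<lambda>_. 1) + ennreal \<rho> * mu (t + k) zeros"
      by (simp only: mu_add mu_cmult)
    also have "\<dots> \<le> ennreal (1 - \<rho>) * ennreal ((1 - \<rho>) ^ k + \<eta>) + ennreal \<rho> * ennreal \<eta>"
      by (intro add_mono mult_left_mono Suc.IH z) auto
    also have "\<dots> = ennreal ((1 - \<rho>) * ((1 - \<rho>) ^ k + \<eta>) + \<rho> * \<eta>)"
    proof -
      have "0 \<le> 1 - \<rho>" "0 \<le> (1 - \<rho>) ^ k + \<eta>" using \<rho> \<eta> by auto
      then show ?thesis using \<rho> \<eta> by (subst ennreal_plus) (simp_all add: ennreal_mult)
    qed
    also have "(1 - \<rho>) * ((1 - \<rho>) ^ k + \<eta>) + \<rho> * \<eta> = (1 - \<rho>) ^ Suc k + \<eta>" by (simp add: algebra_simps)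
    finally show ?case .
  qed
  then show ?thesis by (simp add: \<rho>_def \<eta>_def)
qed

subsection \<open>Lower bounds\<close>

lemma fork_ET_ge_first:
  assumes "4 * real lam * real r ^ r \<le> real n ^ r"
  shows "ennreal (1 / (16 * real r ^ r) * (real n ^ r / real lam)) \<le> fork_ET n r lam tau"
proof -
  define x where "x = real n ^ r / (4 * real lam * real r ^ r)"
  define L where "L = nat \<lfloor>x\<rfloor>"
  have pos: "real lam > 0" "real r ^ r > 0" "real n ^ r > 0" using lam_pos r_pos n_ge_2 by auto
  have x1: "1 \<le> x" using assms pos by (simp add: x_def)
  have L: "real L \<le> x" "x \<le> real L + 1" "1 \<le> real L" using x1 by (auto simp: L_def)
  have half: "ennreal (1 / 2) \<le> mu s (\<lambda>_. 1)" if "s < L" for s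
  proof -
    have comb: "of_nat m * (2 * of_nat lam * ennreal q) = ennreal (real m * (2 * real lam * q))"
      if "0 \<le> q" for m q
      using that by (simp add: ennreal_mult ennreal_of_nat_eq_real_of_nat)
    have "of_nat (Suc s) * (2 * of_nat lam * single_bound) = ennreal (real (Suc s) * (2 * real lam * (real r ^ r / real n ^ r)))"
      by (rule comb) auto
    also have "\<dots> \<le> ennreal (x * (2 * real lam * (real r ^ r / real n ^ r)))"
      using that L(1) by (intro ennreal_leI mult_right_mono) auto
    also have "x * (2 * real lam * (real r ^ r / real n ^ r)) = 1 / 2"
      using pos by (simp add: x_def field_simps)
    finally have "ennreal 1 \<le> mu s (\<lambda>_. 1) + ennreal (1 / 2)"
      using mu_one_ge[of s] by (auto elim!: order.trans intro!: add_left_mono)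
    then show ?thesis
    proof (cases "mu s (\<lambda>_. 1)")
      case (real a)
      have "mu s (\<lambda>_. 1) + ennreal (1 / 2) = ennreal (a + 1 / 2)"
        unfolding real(2) using real(1) by (subst ennreal_plus) auto
      then have "ennreal 1 \<le> ennreal (a + 1 / 2)" using \<open>ennreal 1 \<le> _\<close> by (simp only:)
      then have "1 \<le> a + 1 / 2" using real(1) by (subst (asm) ennreal_le_iff) auto
      then show ?thesis unfolding real(2) by (intro ennreal_leI) simp
    qed simp
  qed
  have "ennreal (1 / (16 * real r ^ r) * (real n ^ r / real lam)) \<le> ennreal (real L * (1 / 2))"
  proof (rule ennreal_leI)
    have "1 / (16 * real r ^ r) * (real n ^ r / real lam) = x / 4" by (simp add: x_def)
    also have "\<dots> \<le> real L * (1 / 2)" using L by linarith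
    finally show "1 / (16 * real r ^ r) * (real n ^ r / real lam) \<le> real L * (1 / 2)" .
  qed
  also have "\<dots> = (\<Sum>s<L. ennreal (1 / 2))"
    by (subst sum_ennreal) auto
  also have "\<dots> \<le> (\<Sum>s<L. mu s (\<lambda>_. 1) + theta 0 * mu s (trap_avoid 0))"
    by (intro sum_mono order.trans[OF half]) auto
  also have "\<dots> \<le> fork_ET n r lam tau" by (rule fork_ET_ge)
  finally show ?thesis .
qed

lemma trap_hit_bound:
  "mu s (trap_hit w) \<le> ennreal (real lam ^ 2 * real w * (2 * real (2 * r) ^ (2 * r)) / real n ^ (2 * r))"
proof -
  have N: "real n ^ (2 * r) > 0" using n_ge_2 by simp
  have "real r ^ r / real n ^ r \<le> 1"
    using two_r_le_n n_ge_2 by (simp add: divide_le_eq power_mono)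
  also have "1 \<le> real (2 * r) ^ (2 * r)" using r_pos by (intro one_le_power) auto
  finally have c: "real r ^ r / real n ^ r \<le> real (2 * r) ^ (2 * r)" .
  have comb: "of_nat m * (of_nat w * ennreal p + ennreal q * ennreal e) = ennreal (real m * (real w * p + q * e))"
    if "0 \<le> p" "0 \<le> q" "0 \<le> e" for m p q e
    using that by (simp add: ennreal_mult ennreal_of_nat_eq_real_of_nat)
  have "of_nat (lam * lam) * (of_nat w * pair_bound + single_bound * ennreal (real w / real n ^ (2 * r))) =
      ennreal (real (lam * lam) * (real w * (real (2 * r) ^ (2 * r) / real n ^ (2 * r)) +
        real r ^ r / real n ^ r * (real w / real n ^ (2 * r))))"
    by (rule comb) auto
  also have "\<dots> \<le> ennreal (real (lam * lam) * (real w * (real (2 * r) ^ (2 * r) / real n ^ (2 * r)) +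
        real (2 * r) ^ (2 * r) * (real w / real n ^ (2 * r))))"
    using c by (intro ennreal_leI mult_left_mono add_left_mono mult_right_mono) auto
  also have "real (lam * lam) * (real w * (real (2 * r) ^ (2 * r) / real n ^ (2 * r)) +
        real (2 * r) ^ (2 * r) * (real w / real n ^ (2 * r))) =
      real lam ^ 2 * real w * (2 * real (2 * r) ^ (2 * r)) / real n ^ (2 * r)"
    by (simp add: field_simps power2_eq_square)
  finally show ?thesis using mu_trap_hit[of s w] by (rule order.trans[rotated])
qed

lemma fork_ET_ge_trap:
  assumes lam: "real lam \<le> real n ^ r"
    and survive: "(1 - lam / (6 * real n ^ r)) ^ k + real lam * real n * (1 - 1 / (3 * real n)) ^ t \<le> 1 / 4"
    and init: "2 * real lam * real r ^ r / real n ^ r \<le> 1 / 8"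
    and both: "real (t + k) * (real lam ^ 2 * real (2 * r) ^ (2 * r) / real n ^ (2 * r)) \<le> 1 / 8"
    and hit: "2 * (real (t + k) * (real lam ^ 2 * real w * (2 * real (2 * r) ^ (2 * r)) / real n ^ (2 * r))) \<le> 1 / 4"
  shows "ennreal (real n ^ (2 * r) / real lam * (real w / (real tau + real w)) / 8) \<le> fork_ET n r lam tau"
proof -
  let ?T = "t + k"
  define B where "B = (\<Sum>s<?T. mu s (trap_avoid w))"
  have "mu 0 (\<lambda>_. 1) = mu ?T (\<lambda>_. 1) + (\<Sum>s<?T. 2 * mu s only_trap + mu s both)"
    by (rule mu_one_telescope)
  also have "\<dots> \<le> ennreal (1 / 4) + (\<Sum>s<?T. 2 * (mu s (trap_avoid w) +
      ennreal (real lam ^ 2 * real w * (2 * real (2 * r) ^ (2 * r)) / real n ^ (2 * r))) +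
      ennreal (real lam ^ 2 * real (2 * r) ^ (2 * r) / real n ^ (2 * r)))"
  proof (intro add_mono sum_mono mult_left_mono)
    show "mu ?T (\<lambda>_. 1) \<le> ennreal (1 / 4)"
      using mu_one_le[OF lam, of t k] survive by (meson ennreal_leI order.trans)
    fix s
    show "mu s only_trap \<le> mu s (trap_avoid w) +
        ennreal (real lam ^ 2 * real w * (2 * real (2 * r) ^ (2 * r)) / real n ^ (2 * r))"
      using mu_only_trap[of s w] trap_hit_bound[of s w] by (meson add_left_mono order.trans)
    have "of_nat (lam * lam) * pair_bound = ennreal (real lam ^ 2 * real (2 * r) ^ (2 * r) / real n ^ (2 * r))"
      by (simp add: ennreal_mult[symmetric] ennreal_of_nat_eq_real_of_nat power2_eq_square)
    then show "mu s both \<le> ennreal (real lam ^ 2 * real (2 * r) ^ (2 * r) / real n ^ (2 * r))"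
      using mu_both[of s] by simp
  qed simp
  also have "\<dots> = ennreal (1 / 4) + (2 * B +
      (2 * ennreal (real ?T * (real lam ^ 2 * real w * (2 * real (2 * r) ^ (2 * r)) / real n ^ (2 * r))) +
      ennreal (real ?T * (real lam ^ 2 * real (2 * r) ^ (2 * r) / real n ^ (2 * r)))))"
  proof -
    have const: "(\<Sum>s<?T. ennreal a) = ennreal (real ?T * a)" if "0 \<le> a" for a
      using that by (subst sum_ennreal) auto
    show ?thesis
      by (subst (1 2) const[symmetric])
        (simp_all only: B_def sum.distrib sum_distrib_left distrib_left add.assoc,
         auto intro!: divide_nonneg_nonneg)
  qed
  also have "\<dots> \<le> ennreal (1 / 4) + (2 * B + (ennreal (1 / 4) + ennreal (1 / 8)))"
  proof (intro add_left_mono add_mono ennreal_leI both)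
    have "2 * ennreal (real ?T * (real lam ^ 2 * real w * (2 * real (2 * r) ^ (2 * r)) / real n ^ (2 * r))) =
        ennreal (2 * (real ?T * (real lam ^ 2 * real w * (2 * real (2 * r) ^ (2 * r)) / real n ^ (2 * r))))"
      by (subst ennreal_mult) auto
    then show "2 * ennreal (real ?T * (real lam ^ 2 * real w * (2 * real (2 * r) ^ (2 * r)) / real n ^ (2 * r)))
        \<le> ennreal (1 / 4)"
      using ennreal_leI[OF hit] by simp
  qed
  also have "\<dots> = 2 * B + ennreal (5 / 8)"
    by (simp add: add_ac flip: ennreal_plus)
  finally have mu0: "mu 0 (\<lambda>_. 1) \<le> 2 * B + ennreal (5 / 8)" .
  have "2 * of_nat lam * single_bound = ennreal (2 * real lam * real r ^ r / real n ^ r)"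
    by (simp add: ennreal_mult[symmetric] ennreal_of_nat_eq_real_of_nat ennreal_numeral[symmetric] del: ennreal_numeral)
  also have "\<dots> \<le> ennreal (1 / 8)" by (intro ennreal_leI init)
  finally have "1 \<le> (2 * B + ennreal (5 / 8)) + ennreal (1 / 8)"
    using mu_zero_one mu0 by (meson add_mono order.trans)
  also have "\<dots> = 2 * B + ennreal (3 / 4)" by (simp add: add.assoc flip: ennreal_plus)
  finally have B: "ennreal (1 / 8) \<le> B"
  proof (cases B)
    case (real b)
    assume "1 \<le> 2 * B + ennreal (3 / 4)"
    moreover have "2 * B + ennreal (3 / 4) = ennreal (2 * b + 3 / 4)"
      using real by (simp add: ennreal_mult)
    ultimately have "ennreal 1 \<le> ennreal (2 * b + 3 / 4)" by (simp only: ennreal_1)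
    then have "1 \<le> 2 * b + 3 / 4" using real by (subst (asm) ennreal_le_iff) auto
    then show ?thesis using real by (simp add: ennreal_leI)
  qed simp
  have "ennreal (real n ^ (2 * r) / real lam * (real w / (real tau + real w)) / 8) =
      ennreal (real n ^ (2 * r) / real lam) * ennreal (real w / (real tau + real w)) * ennreal (1 / 8)"
    by (simp add: ennreal_mult[symmetric])
  also have "\<dots> \<le> theta w * B"
    unfolding theta_def using tau_pos one_minus_power_ge[of "real tau" w]
    by (intro mult_mono remaining_all_trap B ennreal_leI) auto
  also have "\<dots> \<le> (\<Sum>s<?T. mu s (\<lambda>_. 1) + theta w * mu s (trap_avoid w))"
    unfolding B_def sum_distrib_left by (intro sum_mono) simp
  also have "\<dots> \<le> fork_ET n r lam tau" by (rule fork_ET_ge)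
  finally show ?thesis .
qed

lemma fork_ET_ge_second:
  fixes C :: real
  defines "K \<equiv> 3 * (real r + 1) * C + 20" and "D \<equiv> real (2 * r) ^ (2 * r)"
  assumes C: "0 \<le> C" and climb: "real lam * real n * ln (real n) \<le> C * real n ^ r"
    and lam: "real lam * real n \<le> real n ^ r" and large: "32 * K * D \<le> real n"
  shows "ennreal (1 / (256 * K * D) * (real n ^ (2 * r) / real lam * (real n ^ r / (real n ^ r + real tau * real lam))))
    \<le> fork_ET n r lam tau"
proof -
  define N where "N = real n ^ r"
  define \<delta> where "\<delta> = 1 / (32 * K * D)"
  define y where "y = N / real lam"
  define t where "t = nat \<lceil>3 * (real r + 1) * (real n * ln (real n))\<rceil>"
  define k where "k = nat \<lceil>18 * y\<rceil>"
  define w where "w = nat \<lceil>\<delta> * y\<rceil>"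
  have l: "real lam > 0" using lam_pos by simp
  have n0: "real n \<ge> 2" using n_ge_2 by simp
  have N0: "N > 0" using n0 by (simp add: N_def)
  have N2: "real n ^ (2 * r) = N ^ 2" by (simp add: N_def power_mult mult.commute[of 2])
  have D1: "D \<ge> 1" unfolding D_def using r_pos by (intro one_le_power) auto
  have "3 * (real r + 1) * C \<ge> 0" using C by simp
  then have K1: "K \<ge> 20" by (simp add: K_def)
  have KD: "20 * 1 \<le> K * D" using K1 D1 by (intro mult_mono) auto
  have \<delta>0: "0 < \<delta>" "\<delta> \<le> 1" using KD by (auto simp: \<delta>_def field_simps)
  have y0: "y > 0" "real n \<le> y" "real lam * y = N"
    using l N0 lam by (auto simp: y_def N_def[symmetric] field_simps)
  have \<delta>y: "1 \<le> \<delta> * y"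
  proof -
    have "1 \<le> \<delta> * real n" using large KD by (simp add: \<delta>_def field_simps)
    also have "\<dots> \<le> \<delta> * y" using \<delta>0 y0 by (intro mult_left_mono) auto
    finally show ?thesis .
  qed
  have ln0: "0 \<le> ln (real n)" using n0 by simp
  have cl: "real n * ln (real n) \<le> C * y"
    using climb l by (simp add: y_def N_def field_simps)
  have t: "3 * (real r + 1) * (real n * ln (real n)) \<le> real t"
    "real t \<le> 3 * (real r + 1) * (real n * ln (real n)) + 1"
    using ln0 by (auto simp: t_def)
  have k: "18 * y \<le> real k" "real k \<le> 18 * y + 1" using y0 by (auto simp: k_def)
  have w: "\<delta> * y \<le> real w" "real w \<le> \<delta> * y + 1" using \<delta>y by (auto simp: w_def)
  have T: "real (t + k) \<le> K * y"
  proof -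
    have "3 * (real r + 1) * (real n * ln (real n)) \<le> 3 * (real r + 1) * (C * y)"
      using cl by (intro mult_left_mono) auto
    then have "real (t + k) \<le> 3 * (real r + 1) * (C * y) + 18 * y + 2"
      using t k unfolding of_nat_add by linarith
    also have "2 \<le> 2 * y" using y0 n0 by simp
    finally show ?thesis by (simp add: K_def algebra_simps)
  qed
  have w2: "real w \<le> 2 * \<delta> * y" using w \<delta>y by simp
  have "ennreal (real n ^ (2 * r) / real lam * (real w / (real tau + real w)) / 8) \<le> fork_ET n r lam tau"
  proof (rule fork_ET_ge_trap[of k t])
    have "real lam * 1 \<le> real lam * real n" using n0 by (intro mult_left_mono) auto
    then show lamN: "real lam \<le> real n ^ r" using lam by linarith
    have "real lam \<le> 6 * real n ^ r" using lamN by linarith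
    then have "(1 - lam / (6 * real n ^ r)) ^ k \<le> exp (- (lam / (6 * real n ^ r) * real k))"
      using N0 by (intro one_minus_power_le_exp) (auto simp: N_def divide_le_eq)
    also have "\<dots> \<le> exp (- 3)"
    proof -
      have "lam / (6 * N) * (18 * y) \<le> lam / (6 * N) * real k"
        using k N0 by (intro mult_left_mono) auto
      moreover have "lam / (6 * N) * (18 * y) = 3" using y0(3) N0 by (simp add: field_simps)
      ultimately show ?thesis by (simp add: N_def)
    qed
    also have "exp (- 3 :: real) \<le> 1 / 8"
    proof -
      have "(2 :: real) ^ 3 \<le> exp 1 ^ 3" using exp_ge_add_one_self[of 1] by (intro power_mono) auto
      also have "\<dots> = exp 3" by (simp flip: exp_of_nat_mult)
      finally show ?thesis by (simp add: exp_minus field_simps)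
    qed
    finally have a: "(1 - lam / (6 * real n ^ r)) ^ k \<le> 1 / 8" .
    have "(1 - 1 / (3 * real n)) ^ t \<le> exp (- (1 / (3 * real n) * real t))"
      using n0 by (intro one_minus_power_le_exp) (auto simp: field_simps)
    also have "\<dots> \<le> exp (- (real (Suc r) * ln (real n)))"
    proof -
      have "1 / (3 * real n) * (3 * (real r + 1) * (real n * ln (real n))) \<le> 1 / (3 * real n) * real t"
        using t n0 by (intro mult_left_mono) auto
      moreover have "1 / (3 * real n) * (3 * (real r + 1) * (real n * ln (real n))) = real (Suc r) * ln (real n)"
        using n0 by (simp add: field_simps)
      ultimately show ?thesis by simp
    qed
    also have "\<dots> = 1 / real n ^ Suc r"
      using n0 by (simp only: exp_minus exp_of_nat_mult exp_ln) (simp add: field_simps)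
    finally have "real lam * real n * (1 - 1 / (3 * real n)) ^ t \<le> real n ^ r * (1 / real n ^ Suc r)"
      using lam n0 by (intro mult_mono) (auto simp: field_simps)
    also have "\<dots> = 1 / real n" using n0 by simp
    also have "\<dots> \<le> 1 / 8" using large KD by (intro divide_left_mono) auto
    finally show "(1 - lam / (6 * real n ^ r)) ^ k + real lam * real n * (1 - 1 / (3 * real n)) ^ t \<le> 1 / 4"
      using a by simp
    show "2 * real lam * real r ^ r / real n ^ r \<le> 1 / 8"
    proof -
      have "real r ^ r \<le> real (2 * r) ^ r" by (intro power_mono) auto
      also have "\<dots> \<le> D" unfolding D_def using r_pos by (intro power_increasing) auto
      finally have "real r ^ r \<le> D" .
      moreover have "20 * D \<le> K * D" using K1 D1 by (intro mult_right_mono) auto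
      moreover have "32 * (K * D) \<le> real n" using large by (simp only: mult.assoc)
      ultimately have "16 * real r ^ r \<le> real n" using D1 by linarith
      then have "real lam * (16 * real r ^ r) \<le> real lam * real n" by (intro mult_left_mono) auto
      then have "16 * real lam * real r ^ r \<le> N" using lam by (simp add: N_def mult_ac)
      then show ?thesis using N0 by (simp add: N_def field_simps)
    qed
    have ll: "real lam ^ 2 / N ^ 2 = 1 / y ^ 2" using l N0 by (simp add: y_def power_divide)
    show "real (t + k) * (real lam ^ 2 * real (2 * r) ^ (2 * r) / real n ^ (2 * r)) \<le> 1 / 8"
    proof -
      have "real (t + k) * (real lam ^ 2 * D / N ^ 2) = real (t + k) * (D * (real lam ^ 2 / N ^ 2))" by simp
      also have "\<dots> \<le> (K * y) * (D * (real lam ^ 2 / N ^ 2))" using D1 by (intro mult_right_mono T) auto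
      also have "\<dots> = K * D / y" unfolding ll using y0 by (simp add: power2_eq_square)
      also have "\<dots> \<le> 1 / 8" using y0 large KD by (simp add: divide_le_eq)
      finally show ?thesis by (simp only: D_def N2)
    qed
    show "2 * (real (t + k) * (real lam ^ 2 * real w * (2 * real (2 * r) ^ (2 * r)) / real n ^ (2 * r))) \<le> 1 / 4"
    proof -
      have "2 * (real (t + k) * (real lam ^ 2 * real w * (2 * D) / N ^ 2)) =
          4 * D * (real lam ^ 2 / N ^ 2) * (real (t + k) * real w)" by simp
      also have "\<dots> \<le> 4 * D * (real lam ^ 2 / N ^ 2) * ((K * y) * (2 * \<delta> * y))"
        using D1 K1 y0 by (intro mult_left_mono mult_mono T w2) auto
      also have "\<dots> = 8 * (K * D) * \<delta>" unfolding ll using y0 by (simp add: power2_eq_square)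
      also have "\<dots> = 1 / 4" using K1 D1 by (simp add: \<delta>_def)
      finally show ?thesis by (simp only: D_def N2)
    qed
  qed
  moreover have "1 / (256 * K * D) * (real n ^ (2 * r) / real lam * (real n ^ r / (real n ^ r + real tau * real lam)))
      \<le> real n ^ (2 * r) / real lam * (real w / (real tau + real w)) / 8"
  proof -
    have t0: "real tau > 0" using tau_pos by simp
    have "\<delta> * (N / (N + real tau * real lam)) = \<delta> * y / (y + real tau)"
      using l N0 y0 by (simp add: y_def field_simps)
    also have "\<dots> \<le> \<delta> * y / (\<delta> * y + real tau)"
      using \<delta>0 y0 t0 by (intro divide_left_mono add_right_mono) (auto intro!: mult_pos_pos add_pos_pos mult_left_le_one_le)
    also have "\<dots> \<le> real w / (real tau + real w)"
    proof -
      have "\<delta> * y * real tau \<le> real w * real tau" using w(1) t0 by (intro mult_right_mono) auto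
      then show ?thesis using t0 \<delta>0 y0 \<delta>y w by (simp add: divide_simps) (simp add: algebra_simps)
    qed
    finally have "N ^ 2 / real lam * (\<delta> * (N / (N + real tau * real lam))) / 8 \<le>
        N ^ 2 / real lam * (real w / (real tau + real w)) / 8"
      by (intro divide_right_mono mult_left_mono) auto
    then show ?thesis unfolding N2 N_def[symmetric] \<delta>_def by (simp add: mult_ac)
  qed
  ultimately show ?thesis using ennreal_leI order.trans by blast
qed

end

theorem theorem6:
  fixes r :: nat and lam :: "nat \<Rightarrow> nat" and tau :: "nat \<Rightarrow> nat"
  assumes "r \<ge> 2"
    and "\<forall>\<^sub>F n in at_top. 2 * real r * ln (real n) \<le> real (lam n)"
    and "(\<lambda>n. real (lam n)) \<in> O(\<lambda>n. real n ^ (r - 1) / ln (real n))"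
    and "\<And>n. tau n \<ge> 1"
    and "mono tau"
  shows "\<exists>c > 0. \<forall>\<^sub>F n in at_top.
           ennreal (c * ((real n ^ (3 * r) + real (tau n) * real (lam n) * real n ^ r)
                         / (real (lam n) * real n ^ r + real (tau n) * real (lam n) ^ 2)))
           \<le> fork_ET n r (lam n) (tau n)"
proof -
  obtain C where C: "C > 0"
    and O: "\<forall>\<^sub>F n in at_top. norm (real (lam n)) \<le> C * norm (real n ^ (r - 1) / ln (real n))"
    using landau_o.bigE[OF assms(3)] by blast
  define K where "K = 3 * (real r + 1) * C + 20"
  define D where "D = real (2 * r) ^ (2 * r)"
  define a where "a = 1 / (16 * real r ^ r)"
  define b where "b = 1 / (256 * K * D)"
  define c where "c = min a b / 2"
  have K0: "K > 0" using C by (auto simp: K_def intro!: add_nonneg_pos)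
  have D0: "D > 0" using assms(1) by (simp add: D_def)
  have a0: "a > 0" using assms(1) by (simp add: a_def)
  have b0: "b > 0" using K0 D0 by (simp add: b_def)
  have c0: "c > 0" using a0 b0 by (simp add: c_def)
  have e1: "\<forall>\<^sub>F n in at_top. max 1 C \<le> ln (real n)"
    using filterlim_compose[OF ln_at_top filterlim_real_sequentially] unfolding filterlim_at_top by blast
  have e2: "\<forall>\<^sub>F n in at_top. max (max (32 * K * D) (2 * real r)) (4 * real r ^ r) \<le> real n"
    using filterlim_real_sequentially unfolding filterlim_at_top by blast
  have "\<forall>\<^sub>F n in at_top. ennreal (c * ((real n ^ (3 * r) + real (tau n) * real (lam n) * real n ^ r)
      / (real (lam n) * real n ^ r + real (tau n) * real (lam n) ^ 2))) \<le> fork_ET n r (lam n) (tau n)"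
    using assms(2) O e1 e2
  proof eventually_elim
    case (elim n)
    define l where "l = real (lam n)"
    define N where "N = real n ^ r"
    define s where "s = real (tau n)"
    have ln1: "1 \<le> ln (real n)" "C \<le> ln (real n)" using elim(3) by auto
    have big: "32 * K * D \<le> real n" "2 * real r \<le> real n" "4 * real r ^ r \<le> real n" using elim(4) by auto
    have n0: "real n > 0" using big(2) assms(1) by simp
    have "0 < 2 * real r * ln (real n)" using assms(1) ln1(1) by simp
    then have l0: "l > 0" using elim(1) by (simp add: l_def)
    have s1: "s \<ge> 1" using assms(4)[of n] by (simp add: s_def)
    have N0: "N > 0" using n0 by (simp add: N_def)
    interpret fork_model n r "lam n" "tau n"
      using assms(1) assms(4)[of n] l0 big(2) by unfold_locales (auto simp: l_def)
    have Nn: "N = real n * real n ^ (r - 1)" using assms(1) by (simp add: N_def power_eq_if)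
    have "l * ln (real n) \<le> C * real n ^ (r - 1)"
    proof -
      have lnp: "ln (real n) > 0" using ln1 by simp
      then have "l \<le> C * real n ^ (r - 1) / ln (real n)" using elim(2) by (simp add: l_def)
      then show ?thesis unfolding pos_le_divide_eq[OF lnp] .
    qed
    then have "real n * (l * ln (real n)) \<le> real n * (C * real n ^ (r - 1))" using n0 by simp
    then have climb: "l * real n * ln (real n) \<le> C * N" by (simp add: Nn mult_ac)
    also have "\<dots> \<le> ln (real n) * N" using ln1 N0 by (intro mult_right_mono) auto
    finally have small: "l * real n \<le> N" using ln1 by (simp add: mult.commute)
    have "l * (4 * real r ^ r) \<le> l * real n" using big l0 by (intro mult_left_mono) auto
    then have "4 * real (lam n) * real r ^ r \<le> real n ^ r" using small by (simp add: l_def N_def mult_ac)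
    from fork_ET_ge_first[OF this] have first: "ennreal (a * (N / l)) \<le> fork_ET n r (lam n) (tau n)"
      by (simp add: a_def N_def l_def)
    have pw: "real n ^ (2 * r) = N ^ 2" "real n ^ (3 * r) = N ^ 3"
      by (simp_all add: N_def mult.commute[of _ r] flip: power_mult)
    have second: "ennreal (b * (N ^ 2 / l * (N / (N + s * l)))) \<le> fork_ET n r (lam n) (tau n)"
      using fork_ET_ge_second[of C, folded K_def D_def l_def s_def N_def] C climb small big(1)
      unfolding pw b_def by simp
    have sl: "0 \<le> s * l" using s1 l0 by simp
    have "(N ^ 3 + s * l * N) / (l * N + s * l ^ 2) =
        N ^ 2 / l * (N / (N + s * l)) + N / l * (s * l / (N + s * l))"
    proof -
      have "(N ^ 3 + s * l * N) / (l * N + s * l ^ 2) = (N ^ 3 + s * l * N) / (l * (N + s * l))"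
        by (simp add: power2_eq_square algebra_simps)
      also have "\<dots> = N ^ 2 / l * (N / (N + s * l)) + N / l * (s * l / (N + s * l))"
        by (simp add: add_divide_distrib power2_eq_square power3_eq_cube mult_ac)
      finally show ?thesis .
    qed
    also have "\<dots> \<le> N ^ 2 / l * (N / (N + s * l)) + N / l * 1"
      using N0 l0 sl by (intro add_left_mono mult_left_mono) (auto simp: divide_le_eq)
    finally have le: "(N ^ 3 + s * l * N) / (l * N + s * l ^ 2) \<le> N ^ 2 / l * (N / (N + s * l)) + N / l" by simp
    define X where "X = N ^ 2 / l * (N / (N + s * l))"
    define Y where "Y = N / l"
    have XY: "0 \<le> X" "0 \<le> Y" using N0 l0 sl by (auto simp: X_def Y_def)
    have "c * ((N ^ 3 + s * l * N) / (l * N + s * l ^ 2)) \<le> c * (X + Y)"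
      using le c0 by (intro mult_left_mono) (auto simp: X_def Y_def)
    also have "c * (X + Y) = (min a b * X + min a b * Y) / 2" by (simp add: c_def algebra_simps)
    also have "\<dots> \<le> (b * X + a * Y) / 2"
      using XY by (intro divide_right_mono add_mono mult_right_mono) auto
    also have "\<dots> \<le> max (b * X) (a * Y)" by simp
    finally have "ennreal (c * ((N ^ 3 + s * l * N) / (l * N + s * l ^ 2))) \<le> ennreal (max (b * X) (a * Y))"
      by (rule ennreal_leI)
    also have "\<dots> \<le> fork_ET n r (lam n) (tau n)"
      using first second by (auto simp: max_def X_def Y_def)
    finally show ?case unfolding N_def[symmetric] l_def[symmetric] s_def[symmetric] pw .
  qed
  with c0 show ?thesis by blast
qed

end
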